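(* Let $n\geq 1$, $\nu\geq 1$. Let $w\in F_n$ be a cyclically reduced, alternating word of (even) length $k\geq 4$ that is not a proper power. Let $\mathcal{A}$ be the multiset of the integers $a$ ($0\leq a<n$), one for each length-two cyclic subword $x_ix_{i+a}^{-1}$ of $w$, and let $\mathcal{B}$ be the multiset of the integers $b$ ($0\leq b<n$), one for each length-two cyclic subword $x_i^{-1}x_{i+b}$ of $w$ (subscripts mod $n$). Suppose that the cyclic presentation $P_n(w)$ is irreducible and non-redundant. Then $P_n(w)$ is $(2,k,\nu)$-special if and only if $n=2k$, $\nu=2$, $\mathcal{A}$ and $\mathcal{B}$ each consist of $k/2$ distinct odd integers, and if $a\in\mathcal{A}$ then $n-a\notin\mathcal{A}$, and if $b\in\mathcal{B}$ then $n-b\notin\mathcal{B}$.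
   Context: Cyclic presentations: $F_n$ is the free group with basis $x_0,\ldots,x_{n-1}$ and $\theta:F_n\to F_n$ is the automorphism $\theta(x_i)=x_{i+1}$ (subscripts mod $n$). For a cyclically reduced word $w\in F_n$, $P_n(w)=\langle x_0,\ldots,x_{n-1}\mid w,\theta(w),\ldots,\theta^{n-1}(w)\rangle$. Throughout it is assumed that $x_0$ is a letter of $w$. $P_n(w)$ is irreducible if the greatest common divisor of $n$ and the subscripts of the generators appearing in $w$ is $1$. A word is alternating if it has no cyclic subword of the form $(x_ix_j)^{\pm1}$. The word $w$ is a proper power if $w=v^t$ for some $v$ and some $t\geq 2$. Non-redundant: a relator $r\in R$ of $\langle X\mid R\rangle$ is freely redundant if it is freely trivial or there is $s\in R$ such that $r,s$ are distinct elements of the free group on $X$ and $r$ is freely conjugate to $s$ or to $s^{-1}$. A presentation is non-redundant if it contains no freely redundant relator. Star graph: let $\tilde R$ be the set of all cyclic permutations of elements of $R\cup R^{-1}$. The star graph of $\langle X\mid R\rangle$ (all relators cyclically reduced) is the undirected graph, possibly with multiple edges, with vertex set $X\cup X^{-1}$ and an edge joining $x$ and $y$ for each distinct word of the form $xy^{-1}u$ in $\tilde R$, where the edges corresponding to the inverse pair $xy^{-1}u$, $yx^{-1}u^{-1}$ are identified. Special presentations: let $m\geq 2$, $k\geq 3$, $\nu\geq 1$. A finite presentation $\langle X\mid R\rangle$ is $(m,k,\nu)$-special if (a) its star graph has exactly $\nu$ connected components, which are pairwise isomorphic, each a connected bipartite graph of diameter $m$ and girth $2m$ in which each vertex has degree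 at least $3$; (b) each relator has length $k$; (c) if $m=2$ then $k\geq 4$. Girth is the length of a shortest closed path in which consecutive edges are never equal (so a pair of parallel edges gives such a path of length $2$). *)

theory Defs
  imports "HOL-Algebra.Group" "HOL-Library.Multiset" "HOL-Library.Extended_Nat"
begin

text \<open>The letter \<open>(x, True)\<close> is the generator \<open>x\<close> and \<open>(x, False)\<close> is its inverse.\<close>

type_synonym 'a letter = "'a \<times> bool"
type_synonym 'a word = "'a letter list"

definition linv :: "'a letter \<Rightarrow> 'a letter" where
  "linv l = (fst l, \<not> snd l)"

definition winv :: "'a word \<Rightarrow> 'a word" where
  "winv u = rev (map linv u)"

definition reduced :: "'a word \<Rightarrow> bool" where
  "reduced u \<longleftrightarrow> successively (\<lambda>p q. q \<noteq> linv p) u"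

definition cyclically_reduced :: "'a word \<Rightarrow> bool" where
  "cyclically_reduced u \<longleftrightarrow> reduced u \<and> (u \<noteq> [] \<longrightarrow> hd u \<noteq> linv (last u))"

definition cancel_cons :: "'a letter \<Rightarrow> 'a word \<Rightarrow> 'a word" where
  "cancel_cons p u = (case u of [] \<Rightarrow> [p] | q # v \<Rightarrow> if q = linv p then v else p # u)"

definition reduce :: "'a word \<Rightarrow> 'a word" where
  "reduce u = foldr cancel_cons u []"

text \<open>The free group with basis \<open>X\<close>; its elements are represented by their reduced words.\<close>

definition free_group :: "'a set \<Rightarrow> 'a word monoid" where
  "free_group X = \<lparr>carrier = {u. reduced u \<and> fst ` set u \<subseteq> X},
                   monoid.mult = (\<lambda>u v. reduce (u @ v)), one = []\<rparr>"

lemma linv_linv [simp]: "linv (linv p) = p"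
  by (simp add: linv_def)

lemma fst_linv [simp]: "fst (linv p) = fst p"
  by (simp add: linv_def)

lemma reduced_Nil [simp]: "reduced []"
  by (simp add: reduced_def)

lemma reduced_ConsD: "reduced (p # u) \<Longrightarrow> reduced u"
  by (cases u) (auto simp: reduced_def)

lemma reduced_cancel_cons: "reduced u \<Longrightarrow> reduced (cancel_cons p u)"
  by (cases u) (auto simp: cancel_cons_def reduced_def successively_Cons)

lemma cancel_cons_reduced: "reduced (p # u) \<Longrightarrow> cancel_cons p u = p # u"
  by (cases u) (auto simp: cancel_cons_def reduced_def)

lemma cancel_cons_linv: "reduced u \<Longrightarrow> cancel_cons (linv p) (cancel_cons p u) = u"
  by (cases u) (auto simp: cancel_cons_def reduced_def successively_Cons split: list.splits)

lemma reduced_foldr: "reduced v \<Longrightarrow> reduced (foldr cancel_cons u v)"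
  by (induction u) (auto intro: reduced_cancel_cons)

lemma reduced_reduce [simp]: "reduced (reduce u)"
  by (simp add: reduce_def reduced_foldr)

lemma reduce_reduced: "reduced u \<Longrightarrow> reduce u = u"
  unfolding reduce_def
proof (induction u)
  case (Cons p u)
  then show ?case using reduced_ConsD[OF Cons.prems] by (simp add: cancel_cons_reduced)
qed simp

lemma foldr_cancel_cons:
  assumes "reduced v"
  shows "foldr cancel_cons (cancel_cons p u) v = cancel_cons p (foldr cancel_cons u v)"
proof (cases u)
  case (Cons q u')
  have "cancel_cons p (cancel_cons (linv p) (foldr cancel_cons u' v)) = foldr cancel_cons u' v"
    using cancel_cons_linv[of "foldr cancel_cons u' v" "linv p"] reduced_foldr[OF assms] by simp
  with Cons show ?thesis by (auto simp: cancel_cons_def[of p "q # u'"])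
qed (simp add: cancel_cons_def)

lemma foldr_reduce:
  "reduced v \<Longrightarrow> foldr cancel_cons (reduce u) v = foldr cancel_cons u v"
  by (induction u) (auto simp: reduce_def foldr_cancel_cons)

lemma reduce_append: "reduce (u @ v) = foldr cancel_cons u (reduce v)"
  by (simp add: reduce_def)

lemma reduce_reduce_append: "reduce (reduce u @ v) = reduce (u @ v)"
  by (simp add: reduce_append foldr_reduce)

lemma reduce_append_reduce: "reduce (u @ reduce v) = reduce (u @ v)"
  by (simp add: reduce_append reduce_reduced)

lemma set_reduce: "set (reduce u) \<subseteq> set u"
  by (induction u) (auto simp: reduce_def cancel_cons_def split: list.splits if_splits)

lemma reduced_winv: "reduced u \<Longrightarrow> reduced (winv u)"
proof -
  assume "reduced u"
  moreover have "(\<lambda>p q. linv q \<noteq> p) = (\<lambda>p q. q \<noteq> linv p)"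
    by (metis linv_linv)
  ultimately show ?thesis
    by (auto simp: reduced_def winv_def successively_map elim!: successively_mono)
qed

lemma foldr_winv: "reduced v \<Longrightarrow> foldr cancel_cons (winv u) (foldr cancel_cons u v) = v"
  by (induction u) (auto simp: winv_def cancel_cons_linv reduced_foldr)

lemma group_free_group: "group (free_group X)"
proof (rule groupI)
  fix u v w assume "u \<in> carrier (free_group X)" "v \<in> carrier (free_group X)"
  then show "u \<otimes>\<^bsub>free_group X\<^esub> v \<in> carrier (free_group X)"
    using set_reduce[of "u @ v"] by (fastforce simp: free_group_def)
next
  fix u v w :: "'a word"
  show "u \<otimes>\<^bsub>free_group X\<^esub> v \<otimes>\<^bsub>free_group X\<^esub> w =
        u \<otimes>\<^bsub>free_group X\<^esub> (v \<otimes>\<^bsub>free_group X\<^esub> w)"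
    by (simp add: free_group_def reduce_reduce_append reduce_append_reduce)
next
  fix u assume u: "u \<in> carrier (free_group X)"
  have "foldr cancel_cons (winv u) (foldr cancel_cons u []) = []"
    by (rule foldr_winv) simp
  moreover have "winv u \<in> carrier (free_group X)"
    using u by (auto simp: free_group_def reduced_winv) (auto simp: winv_def linv_def)
  ultimately show "\<exists>v\<in>carrier (free_group X). v \<otimes>\<^bsub>free_group X\<^esub> u = \<one>\<^bsub>free_group X\<^esub>"
    by (intro bexI[of _ "winv u"]) (auto simp: free_group_def reduce_def)
qed (auto simp: free_group_def reduce_reduced)

lemma inv_free_group:
  assumes "u \<in> carrier (free_group X)"
  shows "inv\<^bsub>free_group X\<^esub> u = winv u"
proof (rule group.inv_equality[OF group_free_group _ assms])
  show "winv u \<otimes>\<^bsub>free_group X\<^esub> u = \<one>\<^bsub>free_group X\<^esub>"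
    using foldr_winv[of "[]" u] by (simp add: free_group_def reduce_def)
  show "winv u \<in> carrier (free_group X)"
    using assms by (auto simp: free_group_def reduced_winv) (auto simp: winv_def linv_def)
qed

definition freely_conjugate :: "'a set \<Rightarrow> 'a word \<Rightarrow> 'a word \<Rightarrow> bool" where
  "freely_conjugate X r s \<longleftrightarrow>
     (\<exists>u\<in>carrier (free_group X). r = u \<otimes>\<^bsub>free_group X\<^esub> s \<otimes>\<^bsub>free_group X\<^esub> inv\<^bsub>free_group X\<^esub> u)"

definition proper_power :: "'a set \<Rightarrow> 'a word \<Rightarrow> bool" where
  "proper_power X w \<longleftrightarrow>
     (\<exists>v\<in>carrier (free_group X). \<exists>t::nat. t \<ge> 2 \<and> w = v [^]\<^bsub>free_group X\<^esub> t)"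

text \<open>The length-two cyclic subwords, one for each position of the word.\<close>

definition cyclic_pairs :: "'a word \<Rightarrow> ('a letter \<times> 'a letter) list" where
  "cyclic_pairs w = zip w (rotate1 w)"

definition alternating :: "'a word \<Rightarrow> bool" where
  "alternating w \<longleftrightarrow>
     (\<nexists>x y. ((x, True), (y, True)) \<in> set (cyclic_pairs w) \<or>
            ((y, False), (x, False)) \<in> set (cyclic_pairs w))"

record 'a presentation =
  gens :: "'a set"
  rels :: "'a word set"

definition freely_redundant :: "'a presentation \<Rightarrow> 'a word \<Rightarrow> bool" where
  "freely_redundant P r \<longleftrightarrow>
     r = \<one>\<^bsub>free_group (gens P)\<^esub> \<or>
     (\<exists>s\<in>rels P. r \<noteq> s \<and>
        (freely_conjugate (gens P) r s \<or>
         freely_conjugate (gens P) r (inv\<^bsub>free_group (gens P)\<^esub> s)))"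

definition non_redundant :: "'a presentation \<Rightarrow> bool" where
  "non_redundant P \<longleftrightarrow> (\<forall>r\<in>rels P. \<not> freely_redundant P r)"

text \<open>An edge has a set of one (for a loop) or two endpoints.\<close>

record ('v, 'e) multigraph =
  verts :: "'v set"
  edges :: "'e set"
  ends :: "'e \<Rightarrow> 'v set"

text \<open>A path is given by its initial vertex and its list of edges.\<close>

fun path :: "('v, 'e) multigraph \<Rightarrow> 'v \<Rightarrow> 'e list \<Rightarrow> 'v \<Rightarrow> bool" where
  "path G u [] v \<longleftrightarrow> u \<in> verts G \<and> u = v"
| "path G u (e # es) v \<longleftrightarrow> u \<in> verts G \<and> e \<in> edges G \<and> (\<exists>x. ends G e = {u, x} \<and> path G x es v)"

definition component_of :: "('v, 'e) multigraph \<Rightarrow> 'v \<Rightarrow> ('v, 'e) multigraph" where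
  "component_of G u =
     (let C = {v. \<exists>es. path G u es v}
      in \<lparr>verts = C, edges = {e \<in> edges G. ends G e \<subseteq> C}, ends = ends G\<rparr>)"

definition components :: "('v, 'e) multigraph \<Rightarrow> ('v, 'e) multigraph set" where
  "components G = component_of G ` verts G"

definition connected_graph :: "('v, 'e) multigraph \<Rightarrow> bool" where
  "connected_graph G \<longleftrightarrow> verts G \<noteq> {} \<and> (\<forall>u\<in>verts G. \<forall>v\<in>verts G. \<exists>es. path G u es v)"

definition bipartite :: "('v, 'e) multigraph \<Rightarrow> bool" where
  "bipartite G \<longleftrightarrow>
     (\<exists>A B. A \<union> B = verts G \<and> A \<inter> B = {} \<and>
            (\<forall>e\<in>edges G. \<exists>a\<in>A. \<exists>b\<in>B. ends G e = {a, b}))"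

definition isomorphic :: "('v, 'e) multigraph \<Rightarrow> ('v, 'e) multigraph \<Rightarrow> bool" where
  "isomorphic G H \<longleftrightarrow>
     (\<exists>f g. bij_betw f (verts G) (verts H) \<and> bij_betw g (edges G) (edges H) \<and>
            (\<forall>e\<in>edges G. ends H (g e) = f ` ends G e))"

text \<open>Loops count twice.\<close>

definition degree :: "('v, 'e) multigraph \<Rightarrow> 'v \<Rightarrow> nat" where
  "degree G v = card {e \<in> edges G. v \<in> ends G e} + card {e \<in> edges G. ends G e = {v}}"

definition distance :: "('v, 'e) multigraph \<Rightarrow> 'v \<Rightarrow> 'v \<Rightarrow> enat" where
  "distance G u v = (INF es\<in>{es. path G u es v}. enat (length es))"

definition diameter :: "('v, 'e) multigraph \<Rightarrow> enat" where
  "diameter G = (SUP u\<in>verts G. SUP v\<in>verts G. distance G u v)"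

definition girth :: "('v, 'e) multigraph \<Rightarrow> enat" where
  "girth G =
     (INF es\<in>{es. es \<noteq> [] \<and> (\<exists>u. path G u es u) \<and> successively (\<noteq>) es}. enat (length es))"

definition sym_closure :: "'a word set \<Rightarrow> 'a word set" where
  "sym_closure R = {rotate i r | i r. r \<in> R \<union> winv ` R}"

text \<open>\<open>flip\<close> sends \<open>x y\<inverse> u\<close> to \<open>y x\<inverse> u\<inverse>\<close>. An edge of the star graph is the pair consisting
  of such a word and its flip; their first letters \<open>x\<close> and \<open>y\<close> are the endpoints.\<close>

fun flip :: "'a word \<Rightarrow> 'a word" where
  "flip (p # q # u) = linv q # linv p # winv u"
| "flip u = u"

definition star_graph :: "'a presentation \<Rightarrow> ('a letter, 'a word set) multigraph" where
  "star_graph P =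
     \<lparr>verts = gens P \<times> UNIV,
      edges = {{z, flip z} | z. z \<in> sym_closure (rels P) \<and> length z \<ge> 2},
      ends = (\<lambda>e. hd ` e)\<rparr>"

definition finite_presentation :: "'a presentation \<Rightarrow> bool" where
  "finite_presentation P \<longleftrightarrow>
     finite (gens P) \<and> finite (rels P) \<and> rels P \<subseteq> carrier (free_group (gens P))"

definition special :: "nat \<Rightarrow> nat \<Rightarrow> nat \<Rightarrow> 'a presentation \<Rightarrow> bool" where
  "special m k \<nu> P \<longleftrightarrow>
     m \<ge> 2 \<and> k \<ge> 3 \<and> \<nu> \<ge> 1 \<and> finite_presentation P \<and>
     (\<forall>r\<in>rels P. cyclically_reduced r) \<and>
     finite (components (star_graph P)) \<and> card (components (star_graph P)) = \<nu> \<and>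
     (\<forall>C\<in>components (star_graph P). \<forall>D\<in>components (star_graph P). isomorphic C D) \<and>
     (\<forall>C\<in>components (star_graph P).
        connected_graph C \<and> bipartite C \<and> diameter C = enat m \<and> girth C = enat (2 * m) \<and>
        (\<forall>v\<in>verts C. degree C v \<ge> 3)) \<and>
     (\<forall>r\<in>rels P. length r = k) \<and>
     (m = 2 \<longrightarrow> k \<ge> 4)"

abbreviation F :: "nat \<Rightarrow> nat word monoid" where
  "F n \<equiv> free_group {0..<n}"

definition theta :: "nat \<Rightarrow> nat word \<Rightarrow> nat word" where
  "theta n = map (\<lambda>(i, s). ((i + 1) mod n, s))"

definition cyclic_presentation :: "nat \<Rightarrow> nat word \<Rightarrow> nat presentation" where
  "cyclic_presentation n w = \<lparr>gens = {0..<n}, rels = {(theta n ^^ i) w | i. i < n}\<rparr>"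

definition subscripts :: "nat word \<Rightarrow> nat set" where
  "subscripts w = fst ` set w"

definition irreducible_cyclic :: "nat \<Rightarrow> nat word \<Rightarrow> bool" where
  "irreducible_cyclic n w \<longleftrightarrow> Gcd (insert n (subscripts w)) = 1"

text \<open>For \<open>i, j < n\<close>, \<open>(j + n - i) mod n\<close> is the unique \<open>a\<close> with \<open>0 \<le> a < n\<close> and
  \<open>j = i + a\<close> modulo \<open>n\<close>.\<close>

definition mset_A :: "nat \<Rightarrow> nat word \<Rightarrow> nat multiset" where
  "mset_A n w = {# (j + n - i) mod n. ((i, s), (j, t)) \<in># {# pq \<in># mset (cyclic_pairs w).
                     snd (fst pq) \<and> \<not> snd (snd pq) #} #}"

definition mset_B :: "nat \<Rightarrow> nat word \<Rightarrow> nat multiset" where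
  "mset_B n w = {# (j + n - i) mod n. ((i, s), (j, t)) \<in># {# pq \<in># mset (cyclic_pairs w).
                     \<not> snd (fst pq) \<and> snd (snd pq) #} #}"

end

theory Submission imports Defs "HOL-Number_Theory.Cong" begin

text \<open>Each of the two components containing \<open>(0, True)\<close> and \<open>(0, False)\<close>
  is a Cayley multigraph of a subgroup of the integers modulo \<open>n\<close>, with a connection set read off
  \<open>\<A>\<close> and \<open>\<B>\<close> respectively. A bipartite graph of diameter 2 and girth 4 is a simple complete
  bipartite graph; here every degree is \<open>k\<close>, so the subgroup has order \<open>2k\<close>. A cyclic group has one
  subgroup of that order, so \<open>\<A>\<close> and \<open>\<B>\<close> generate the same subgroup, which by irreducibility is
  everything: \<open>n = 2k\<close> and \<open>\<nu> = 2\<close>. A shift by 1 then has to swap the two colour classes, so these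
  are the even and the odd subscripts; simplicity of the graph gives the remaining conditions.
  Conversely, those conditions make \<open>\<A> \<union> -\<A>\<close> and \<open>\<B> \<union> -\<B>\<close> the set of all odd residues.\<close>

text \<open>An edge of the star graph comes from two consecutive letters and joins the first to the
  inverse of the second. Alternation gives these two vertices the same sign, so generators and
  inverses are never adjacent, and the letter at a given position always contributes a step of the
  same length. The obstacle is multiplicity: degree \<open>k\<close> presupposes that the
  \<open>n * k\<close> pairs of a relator and a position give different edges. Equal rotations of
  one relator would make \<open>w\<close> a proper power; a rotation shared by two relators, up to
  inversion, would make the presentation redundant; a relator that is a rotation of its own inverse
  is excluded by a reflection argument. Two different edges can then have the same ends in two ways
  only: same start and equal steps, or opposite directions and steps adding up to \<open>n\<close>.
  These are the repetitions within \<A> or \<B> and the pairs \<open>a\<close>, \<open>n - a\<close>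
  that the theorem forbids.\<close>

lemma mod_add_right_cancel:
  fixes a b c n :: nat
  assumes "(a + c) mod n = (b + c) mod n" "a < n" "b < n"
  shows "a = b"
proof -
  have "[a = b] (mod n)" using assms(1) by (simp add: cong_def[symmetric] cong_add_rcancel_nat)
  then show ?thesis using assms by (simp add: cong_def)
qed

section \<open>Complete bipartite multigraphs\<close>

lemma path_append:
  "path G u (es @ fs) v \<longleftrightarrow> (\<exists>x. path G u es x \<and> path G x fs v)"
proof (induction es arbitrary: u)
  case Nil
  show ?case by (cases fs) auto
qed auto

lemma path_end_in_verts: "path G u es v \<Longrightarrow> u \<in> verts G \<and> v \<in> verts G"
  by (induction es arbitrary: u) auto

lemma path_ConsI: "u \<in> verts G \<Longrightarrow> e \<in> edges G \<Longrightarrow> ends G e = {u, x} \<Longrightarrow> path G x es v \<Longrightarrow> path G u (e # es) v"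
  by auto

lemma path_single: "u \<in> verts G \<Longrightarrow> v \<in> verts G \<Longrightarrow> e \<in> edges G \<Longrightarrow> ends G e = {u, v} \<Longrightarrow> path G u [e] v"
  by auto

lemma path_rev: "path G u es v \<Longrightarrow> path G v (rev es) u"
proof (induction es arbitrary: u)
  case (Cons e es)
  then obtain x where x: "u \<in> verts G" "e \<in> edges G" "ends G e = {u, x}" "path G x es v"
    by auto
  then have "path G x [e] u" using path_end_in_verts[OF x(4)] by (auto simp: insert_commute)
  then show ?case using Cons.IH[OF x(4)] unfolding rev.simps path_append by blast
qed simp

section \<open>Connected components\<close>

lemma verts_component_of: "verts (component_of G u) = {v. \<exists>es. path G u es v}"
  and edges_component_of:
    "edges (component_of G u) = {e \<in> edges G. ends G e \<subseteq> verts (component_of G u)}"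
  and ends_component_of [simp]: "ends (component_of G u) = ends G"
  by (simp_all add: component_of_def Let_def)

lemma component_of_eq:
  assumes "path G u es v"
  shows "component_of G u = component_of G v"
proof -
  have "{x. \<exists>es. path G u es x} = {x. \<exists>es. path G v es x}"
    using path_append[of G u es] path_append[of G v "rev es"] assms path_rev[OF assms] by metis
  then show ?thesis by (simp add: component_of_def)
qed

text \<open>An edge that meets a component lies in it, its other end being one step further; so
  degrees in a component can be counted in the whole graph.\<close>

lemma incident_component_of:
  assumes v: "v \<in> verts (component_of G u)"
    and ends: "\<And>e. e \<in> edges G \<Longrightarrow> \<exists>x\<in>verts G. \<exists>y\<in>verts G. ends G e = {x, y}"
  shows "{e \<in> edges (component_of G u). v \<in> ends G e} = {e \<in> edges G. v \<in> ends G e}"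
proof -
  obtain es where es: "path G u es v" using v unfolding verts_component_of by blast
  have "ends G e \<subseteq> verts (component_of G u)" if e: "e \<in> edges G" "v \<in> ends G e" for e
  proof -
    obtain x where x: "x \<in> verts G" "ends G e = {v, x}"
      using ends[OF e(1)] e(2) by (auto simp: insert_commute)
    then have "path G v [e] x" using path_single e path_end_in_verts[OF es] by metis
    then have "path G u (es @ [e]) x" using es unfolding path_append by blast
    then have "x \<in> verts (component_of G u)" unfolding verts_component_of by blast
    then show ?thesis using x v by simp
  qed
  then show ?thesis unfolding edges_component_of by blast
qed

section \<open>Distance and girth in bipartite multigraphs\<close>

lemma path_parity:
  assumes "path C u es v" "X \<inter> Y = {}" "\<And>e. e \<in> edges C \<Longrightarrow> \<exists>a\<in>X. \<exists>b\<in>Y. ends C e = {a, b}"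
  shows "(u \<in> X \<longleftrightarrow> v \<in> X) \<longleftrightarrow> even (length es)"
  using assms(1)
proof (induction es arbitrary: u)
  case (Cons e es)
  then obtain x where x: "e \<in> edges C" "ends C e = {u, x}" "path C x es v"
    by auto
  then have "u \<in> X \<longleftrightarrow> x \<notin> X"
    using assms(2) assms(3)[OF x(1)] by (auto simp: doubleton_eq_iff)
  then show ?case using Cons.IH[OF x(3)] by auto
qed auto

text \<open>Paths between opposite sides have odd length, and an odd length below 3 is 1.\<close>

lemma diameter_two_imp_adjacent:
  assumes "diameter C \<le> 2" "X \<union> Y = verts C" "X \<inter> Y = {}"
    and "\<And>e. e \<in> edges C \<Longrightarrow> \<exists>a\<in>X. \<exists>b\<in>Y. ends C e = {a, b}"
    and "x \<in> X" "y \<in> Y"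
  shows "\<exists>e\<in>edges C. ends C e = {x, y}"
proof -
  have "distance C x y \<le> diameter C"
    using assms unfolding diameter_def by (blast intro: SUP_upper2)
  also have "\<dots> < 3" using assms(1) by (simp add: order_le_less_trans)
  finally obtain es where es: "path C x es y" "length es < 3"
    unfolding distance_def INF_less_iff by (auto simp: numeral_eq_enat)
  have "odd (length es)" using path_parity[OF es(1) assms(3,4)] assms(3,5,6) by blast
  then have "length es = 1" using es(2) by presburger
  then obtain e where "es = [e]" by (auto simp: length_Suc_conv)
  then show ?thesis using es(1) by auto
qed

text \<open>Two parallel edges, walked there and back, form a closed path of length 2.\<close>

lemma girth_imp_no_parallel:
  assumes "girth C > 2" "e \<in> edges C" "e' \<in> edges C" "ends C e = {x, y}" "ends C e' = {x, y}"
    and "x \<in> verts C" "y \<in> verts C"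
  shows "e = e'"
proof (rule ccontr)
  assume "e \<noteq> e'"
  then have "path C x [e, e'] x" "successively (\<noteq>) [e, e']"
    using assms by (auto simp: insert_commute)
  then have "girth C \<le> enat (length [e, e'])"
    unfolding girth_def by (intro INF_lower) blast
  then show False using assms(1) by (auto simp: numeral_eq_enat numeral_2_eq_2 dest: less_le_trans)
qed

text \<open>Sending an edge to its ends matches the edges at \<open>x\<close> with the pairs
  \<open>{x, y}\<close>. The vertex is taken in \<open>X\<close>; exchanging the roles of
  \<open>X\<close> and \<open>Y\<close> serves the other side.\<close>

lemma card_incident_complete_bipartite:
  assumes "X \<inter> Y = {}" "\<And>e. e \<in> E \<Longrightarrow> \<exists>a\<in>X. \<exists>b\<in>Y. h e = {a, b}"
    and "\<And>y. y \<in> Y \<Longrightarrow> \<exists>e\<in>E. h e = {x, y}" and "inj_on h E" "x \<in> X"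
  shows "card {e \<in> E. x \<in> h e} = card Y"
proof -
  have "h ` {e \<in> E. x \<in> h e} = (\<lambda>y. {x, y}) ` Y"
  proof
    show "h ` {e \<in> E. x \<in> h e} \<subseteq> (\<lambda>y. {x, y}) ` Y"
    proof clarify
      fix e assume e: "e \<in> E" "x \<in> h e"
      then obtain a b where "a \<in> X" "b \<in> Y" "h e = {a, b}" using assms(2) by blast
      moreover have "x = a" using calculation e(2) assms(1,5) by blast
      ultimately show "h e \<in> (\<lambda>y. {x, y}) ` Y" by blast
    qed
    show "(\<lambda>y. {x, y}) ` Y \<subseteq> h ` {e \<in> E. x \<in> h e}"
    proof clarify
      fix y assume "y \<in> Y"
      then obtain e where "e \<in> E" "h e = {x, y}" using assms(3) by blast
      then show "{x, y} \<in> h ` {e \<in> E. x \<in> h e}" by (intro image_eqI[of _ _ e]) auto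
    qed
  qed
  moreover have "inj_on (\<lambda>y. {x, y}) Y"
    by (rule inj_onI) (auto simp: doubleton_eq_iff)
  moreover have "inj_on h {e \<in> E. x \<in> h e}"
    by (rule inj_on_subset[OF assms(4)]) simp
  ultimately show ?thesis using card_image[of h "{e \<in> E. x \<in> h e}"] by (simp add: card_image)
qed

text \<open>Two vertices on one side are at distance exactly 2, and two on each side span a 4-cycle.
  Shorter closed paths are excluded by parity and by the absence of parallel edges.\<close>

lemma complete_bipartite:
  assumes verts: "verts C = X \<union> Y" and disj: "X \<inter> Y = {}"
    and ends: "\<And>e. e \<in> edges C \<Longrightarrow> \<exists>a\<in>X. \<exists>b\<in>Y. ends C e = {a, b}"
    and complete: "\<And>x y. x \<in> X \<Longrightarrow> y \<in> Y \<Longrightarrow> \<exists>e\<in>edges C. ends C e = {x, y}"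
    and inj: "inj_on (ends C) (edges C)"
    and X: "x1 \<in> X" "x2 \<in> X" "x1 \<noteq> x2" and Y: "y1 \<in> Y" "y2 \<in> Y" "y1 \<noteq> y2"
  shows "connected_graph C" "bipartite C" "diameter C = 2" "girth C = 4"
proof -
  note parity = path_parity[OF _ disj ends]
  have adj: "\<exists>e\<in>edges C. ends C e = {u, v}" if "u \<in> verts C" "v \<in> verts C" "u \<in> X \<longleftrightarrow> v \<notin> X" for u v
    using that complete[of u v] complete[of v u] verts insert_commute[of u v "{}"]
    by (metis Un_iff)
  have short: "\<exists>es. path C u es v \<and> length es \<le> 2" if uv: "u \<in> verts C" "v \<in> verts C" for u v
  proof (cases "u \<in> X \<longleftrightarrow> v \<notin> X")
    case True
    then obtain e where "e \<in> edges C" "ends C e = {u, v}" using adj uv by blast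
    then show ?thesis using uv path_single[of u C v e] by (intro exI[of _ "[e]"]) simp
  next
    case False
    \<comment> \<open>Vertices on the same side have every vertex of the other side as a common
      neighbour.\<close>
    define z where "z = (if u \<in> X then y1 else x1)"
    have z: "z \<in> verts C" "u \<in> X \<longleftrightarrow> z \<notin> X" "z \<in> X \<longleftrightarrow> v \<notin> X"
      using False X Y disj verts by (auto simp: z_def)
    obtain e e' where "e \<in> edges C" "ends C e = {u, z}" "e' \<in> edges C" "ends C e' = {z, v}"
      using adj[OF uv(1) z(1,2)] adj[OF z(1) uv(2) z(3)] by blast
    then have "path C u [e, e'] v" using uv z by (intro path_ConsI path_single) auto
    then show ?thesis by (intro exI[of _ "[e, e']"]) simp
  qed
  show "connected_graph C"
    unfolding connected_graph_def using short X(1) verts by (metis UnI1 empty_iff)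
  show "bipartite C"
    unfolding bipartite_def
    by (rule exI[of _ X], rule exI[of _ Y]) (use verts disj ends in simp)
  show "diameter C = 2"
  proof (rule antisym)
    show "diameter C \<le> 2"
      unfolding diameter_def
    proof (intro SUP_least)
      fix u v assume "u \<in> verts C" "v \<in> verts C"
      then obtain es where "path C u es v" "length es \<le> 2" using short by blast
      then have "distance C u v \<le> enat (length es)"
        unfolding distance_def by (intro INF_lower) simp
      also have "\<dots> \<le> 2" using \<open>length es \<le> 2\<close> by (simp add: numeral_eq_enat)
      finally show "distance C u v \<le> 2" .
    qed
    have "2 \<le> distance C x1 x2"
      unfolding distance_def
    proof (intro INF_greatest, clarify)
      fix es assume es: "path C x1 es x2"
      then have "even (length es)" "es \<noteq> []" using parity X by auto
      then have "length es \<noteq> 0" "length es \<noteq> 1" by auto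
      then have "length es \<ge> 2" by linarith
      then show "2 \<le> enat (length es)" by (simp add: numeral_eq_enat)
    qed
    also have "\<dots> \<le> diameter C"
      using X verts unfolding diameter_def by (blast intro: SUP_upper2)
    finally show "2 \<le> diameter C" .
  qed
  show "girth C = 4"
  proof (rule antisym)
    obtain e1 e2 e3 e4 where e: "e1 \<in> edges C" "ends C e1 = {x1, y1}"
        "e2 \<in> edges C" "ends C e2 = {x2, y1}"
        "e3 \<in> edges C" "ends C e3 = {x2, y2}"
        "e4 \<in> edges C" "ends C e4 = {x1, y2}"
      using complete[OF X(1) Y(1)] complete[OF X(2) Y(1)] complete[OF X(2) Y(2)] complete[OF X(1) Y(2)]
      by blast
    have ne: "x1 \<noteq> y1" "x1 \<noteq> y2" "x2 \<noteq> y1" "x2 \<noteq> y2"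
      using X Y disj by auto
    have "e1 \<noteq> e2" "e2 \<noteq> e3" "e3 \<noteq> e4"
      using e ne X(3) Y(3) by (auto simp: doubleton_eq_iff)
    moreover have "path C x1 [e1, e2, e3, e4] x1"
    proof (intro path_ConsI path_single)
      show "ends C e1 = {x1, y1}" "ends C e3 = {x2, y2}" by fact+
      show "ends C e2 = {y1, x2}" "ends C e4 = {y2, x1}" using e by (simp_all add: insert_commute)
    qed (use e X Y verts in auto)
    ultimately have "girth C \<le> enat (length [e1, e2, e3, e4])"
      unfolding girth_def by (intro INF_lower) auto
    also have "length [e1, e2, e3, e4] = 4" by simp
    finally show "girth C \<le> 4" by (simp add: numeral_eq_enat)
    show "4 \<le> girth C"
      unfolding girth_def
    proof (intro INF_greatest, clarify)
      fix es u assume es: "es \<noteq> []" "successively (\<noteq>) es" "path C u es u"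
      then have ev: "even (length es)" using parity by auto
      have "length es \<noteq> 2"
      proof
        assume "length es = 2"
        then obtain e f where ef: "es = [e, f]" by (auto simp: length_Suc_conv numeral_2_eq_2)
        then have "e \<in> edges C" "f \<in> edges C" "ends C e = ends C f" "e \<noteq> f"
          using es by auto
        then show False using inj by (auto simp: inj_on_def)
      qed
      moreover have "length es \<noteq> 0" "length es \<noteq> 1" "length es \<noteq> 3"
        using ev es(1) by auto
      ultimately have "length es \<ge> 4" by linarith
      then show "4 \<le> enat (length es)" by (simp add: numeral_eq_enat)
    qed
  qed
qed

text \<open>In a simple graph an edge is determined by its ends, so a vertex bijection that matches
  the end sets dictates the edge bijection: the image of the ends is pulled back through
  \<open>ends D\<close>.\<close>

lemma isomorphic_simple:
  assumes f: "bij_betw f (verts C) (verts D)"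
    and C: "inj_on (ends C) (edges C)" "\<And>e. e \<in> edges C \<Longrightarrow> ends C e \<subseteq> verts C"
    and D: "inj_on (ends D) (edges D)"
    and img: "(\<lambda>e. f ` ends C e) ` edges C = ends D ` edges D"
  shows "isomorphic C D"
proof -
  define g where "g = inv_into (edges D) (ends D) \<circ> (\<lambda>e. f ` ends C e)"
  have "inj_on f (verts C)" using f by (simp add: bij_betw_def)
  then have "inj_on (\<lambda>e. f ` ends C e) (edges C)"
    using C(1) C(2) inj_on_image_eq_iff[of f "verts C"] by (intro inj_onI) (metis inj_onD)
  then have 1: "bij_betw (\<lambda>e. f ` ends C e) (edges C) (ends D ` edges D)"
    using img by (simp add: bij_betw_def)
  have "bij_betw (ends D) (edges D) (ends D ` edges D)" using D by (simp add: bij_betw_def)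
  then have "bij_betw g (edges C) (edges D)"
    unfolding g_def using bij_betw_trans[OF 1 bij_betw_inv_into] by blast
  moreover have "ends D (g e) = f ` ends C e" if "e \<in> edges C" for e
    using that img by (auto simp: g_def intro!: f_inv_into_f)
  ultimately show ?thesis using f unfolding isomorphic_def by blast
qed

section \<open>Circulant pairs of multigraphs\<close>

text \<open>The least positive element generates, by division with remainder; \<open>n\<close>
  guarantees that there is a positive element. The subgroup in question will be the set of residues
  reachable in a component, lifted to the integers.\<close>

lemma int_subgroup:
  fixes H :: "int set"
  assumes "0 \<in> H" and diff: "\<And>x y. x \<in> H \<Longrightarrow> y \<in> H \<Longrightarrow> x - y \<in> H"
    and "int n \<in> H" "0 < n"
  obtains g :: nat where "0 < g" "H = {m. int g dvd m}"
proof -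
  define g where "g = (LEAST g. 0 < g \<and> int g \<in> H)"
  have g: "0 < g" "int g \<in> H"
    using LeastI[of "\<lambda>g. 0 < g \<and> int g \<in> H" n] assms unfolding g_def by auto
  have least: "g \<le> h" if "0 < h" "int h \<in> H" for h
    unfolding g_def using that by (intro Least_le) simp
  have add: "x + y \<in> H" if "x \<in> H" "y \<in> H" for x y
    using diff[OF that(1) diff[OF assms(1) that(2)]] by simp
  have mult_nat: "int m * int g \<in> H" for m
    by (induction m) (auto simp: assms(1) distrib_right intro!: add g)
  have mult: "m * int g \<in> H" for m
    using mult_nat diff[OF assms(1)] by (cases m rule: int_cases2) (metis diff_0 minus_mult_left)+
  have "int g dvd m" if m: "m \<in> H" for m
  proof (rule ccontr)
    assume "\<not> int g dvd m"
    then have "m mod int g \<noteq> 0" by (simp add: mod_eq_0_iff_dvd)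
    moreover have "m mod int g \<ge> 0" using g by simp
    ultimately have pos: "m mod int g > 0" by linarith
    have "m mod int g = m - (m div int g) * int g" by (simp add: minus_div_mult_eq_mod)
    then have "m mod int g \<in> H" using diff[OF m mult] by simp
    then have "g \<le> nat (m mod int g)" using pos by (intro least) simp_all
    moreover have "m mod int g < int g" using g by simp
    ultimately show False using pos by linarith
  qed
  moreover have "m \<in> H" if "int g dvd m" for m
    using mult that by (metis dvd_div_mult_self)
  ultimately have "H = {m. int g dvd m}" by blast
  then show ?thesis using that g by blast
qed

lemma card_multiples_below:
  fixes g n :: nat
  assumes "0 < g" "g dvd n"
  shows "card {i. i < n \<and> g dvd i} = n div g"
proof -
  have "{i. i < n \<and> g dvd i} = (*) g ` {..<n div g}"
  proof (intro equalityI subsetI)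
    fix i assume "i \<in> {i. i < n \<and> g dvd i}"
    then have "i = g * (i div g)" "i div g < n div g"
      using assms by (auto intro: div_less_mono)
    then show "i \<in> (*) g ` {..<n div g}" by blast
  next
    fix i assume "i \<in> (*) g ` {..<n div g}"
    then obtain j where j: "i = g * j" "j < n div g" by blast
    then have "g * j < g * (n div g)" using assms(1) by (intro mult_less_mono2)
    moreover have "g * (n div g) = n" using assms by simp
    ultimately have "i < n" using j(1) by metis
    then show "i \<in> {i. i < n \<and> g dvd i}" using j(1) by simp
  qed
  moreover have "inj_on ((*) g) {..<n div g}"
    using assms by (simp add: inj_on_def)
  ultimately show ?thesis by (simp add: card_image)
qed

text \<open>The star graph stripped of its words: \<open>edge_at (j, p)\<close> is the edge read at
  position \<open>p\<close> of the relator whose letter there has subscript \<open>j\<close>.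
  Labelling the edges bijectively, instead of by their ends, keeps parallel edges apart.\<close>

locale circulant_pair =
  fixes n k :: nat and sign :: "nat \<Rightarrow> bool" and step :: "nat \<Rightarrow> nat"
    and G :: "(nat \<times> bool, 'e) multigraph" and edge_at :: "nat \<times> nat \<Rightarrow> 'e"
  assumes verts: "verts G = {..<n} \<times> UNIV"
    and bij: "bij_betw edge_at ({..<n} \<times> {..<k}) (edges G)"
    and ends: "\<And>j p. j < n \<Longrightarrow> p < k \<Longrightarrow>
      ends G (edge_at (j, p)) = {(j, sign p), ((j + step p) mod n, sign p)}"
    and card_sign: "\<And>b. card {p. p < k \<and> sign p = b} = k div 2"
    and even_k: "even k" and k_ge: "k \<ge> 4"
    and step_pos: "\<And>p. p < k \<Longrightarrow> 0 < step p"
    and step_less: "\<And>p. p < k \<Longrightarrow> step p < n"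
begin

lemma n_pos: "0 < n"
  using step_less[of 0] k_ge by simp

definition S :: "bool \<Rightarrow> nat set" where
  "S b = {p. p < k \<and> sign p = b}"

lemma S_D: "p \<in> S b \<Longrightarrow> p < k \<and> sign p = b \<and> 0 < step p \<and> step p < n"
  by (auto simp: S_def step_pos step_less)

lemma card_S: "card (S b) = k div 2" and finite_S: "finite (S b)"
  using card_sign[of b] by (auto simp: S_def)

lemma edge_cases:
  assumes "e \<in> edges G"
  obtains j p b where "j < n" "p \<in> S b" "e = edge_at (j, p)"
    "ends G e = {(j, b), ((j + step p) mod n, b)}"
proof -
  have "e \<in> edge_at ` ({..<n} \<times> {..<k})"
    using assms bij_betw_imp_surj_on[OF bij] by simp
  then obtain j p where "j < n" "p < k" "e = edge_at (j, p)" by blast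
  then show ?thesis using that[of j p "sign p"] ends by (auto simp: S_def)
qed

lemma edge_at_edge: "j < n \<Longrightarrow> p \<in> S b \<Longrightarrow> edge_at (j, p) \<in> edges G"
  using S_D[of p b] unfolding bij_betw_imp_surj_on[OF bij, symmetric] by (intro imageI) simp

lemma ends_edge_at: "j < n \<Longrightarrow> p \<in> S b \<Longrightarrow>
    ends G (edge_at (j, p)) = {(j, b), ((j + step p) mod n, b)}"
  using ends S_D by blast

lemma edge_at_inject:
  assumes "edge_at (i, p) = edge_at (j, q)" "i < n" "j < n" "p \<in> S b" "q \<in> S b"
  shows "i = j \<and> p = q"
  using inj_onD[OF bij_betw_imp_inj_on[OF bij] assms(1)] assms S_D by auto

lemma edge_ends_verts: "e \<in> edges G \<Longrightarrow> \<exists>x\<in>verts G. \<exists>y\<in>verts G. ends G e = {x, y}"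
proof (erule edge_cases)
  fix j p b assume *: "j < n" "ends G e = {(j, b), ((j + step p) mod n, b)}"
  then have "(j, b) \<in> verts G" "((j + step p) mod n, b) \<in> verts G"
    using n_pos verts by simp_all
  then show ?thesis using *(2) by metis
qed

lemma add_step_neq:
  assumes "j < n" "p \<in> S b" shows "(j + step p) mod n \<noteq> j"
proof
  assume "(j + step p) mod n = j"
  then have "(j + step p) mod n = j mod n" using assms by simp
  then have "n dvd (j + step p) - j" by (metis le_add1 mod_eq_dvd_iff_nat)
  then show False using S_D[OF assms(2)] by (auto dest: dvd_imp_le)
qed

text \<open>The start of the edge with label \<open>p\<close> that ends at \<open>i\<close>; adding
  \<open>n - step p\<close> stands for subtracting \<open>step p\<close> modulo
  \<open>n\<close>.\<close>

definition source :: "nat \<Rightarrow> nat \<Rightarrow> nat" where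
  "source i p = (i + (n - step p)) mod n"

lemma source: "i < n \<Longrightarrow> p \<in> S b \<Longrightarrow> source i p < n \<and> (source i p + step p) mod n = i"
  using S_D[of p b] n_pos unfolding source_def mod_add_left_eq by simp

lemma source_of_target:
  assumes "j < n" "p \<in> S b" shows "source ((j + step p) mod n) p = j"
  using assms S_D[of p b] unfolding source_def mod_add_left_eq by simp

text \<open>Half of the edges at a vertex start there and half end there, one for each position of
  the right sign. The halves are disjoint because no step is 0 modulo \<open>n\<close>, so there are
  no loops.\<close>

lemma card_incident:
  assumes "i < n"
  shows "card {e \<in> edges G. (i, b) \<in> ends G e} = k"
proof -
  let ?A = "(\<lambda>p. edge_at (i, p)) ` S b" and ?B = "(\<lambda>p. edge_at (source i p, p)) ` S b"
  have "{e \<in> edges G. (i, b) \<in> ends G e} = ?A \<union> ?B"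
  proof
    show "{e \<in> edges G. (i, b) \<in> ends G e} \<subseteq> ?A \<union> ?B"
    proof clarify
      fix e assume e: "e \<in> edges G" "(i, b) \<in> ends G e" "e \<notin> ?B"
      from e(1) show "e \<in> ?A"
      proof (rule edge_cases)
        fix j p c assume *: "j < n" "p \<in> S c" "e = edge_at (j, p)"
          "ends G e = {(j, c), ((j + step p) mod n, c)}"
        then have "c = b" "j = i \<or> (j + step p) mod n = i" using e(2) by auto
        moreover have "e \<in> ?B" if "(j + step p) mod n = i"
          using source_of_target[OF *(1,2)] *(2,3) \<open>c = b\<close> that
          by (intro image_eqI[of _ _ p]) simp_all
        ultimately show "e \<in> ?A" using *(2,3) e(3) by auto
      qed
    qed
    show "?A \<union> ?B \<subseteq> {e \<in> edges G. (i, b) \<in> ends G e}"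
    proof
      fix e assume "e \<in> ?A \<union> ?B"
      then obtain p where p: "p \<in> S b" "e = edge_at (i, p) \<or> e = edge_at (source i p, p)"
        by blast
      then show "e \<in> {e \<in> edges G. (i, b) \<in> ends G e}"
        using source[OF assms p(1)] edge_at_edge[OF _ p(1)] ends_edge_at[OF _ p(1)] assms
        by (elim disjE) simp_all
    qed
  qed
  moreover have "?A \<inter> ?B = {}"
  proof -
    have False if pq: "p \<in> S b" "q \<in> S b" "edge_at (i, p) = edge_at (source i q, q)" for p q
    proof -
      have "i = source i q" using edge_at_inject[OF pq(3) assms _ pq(1,2)] source[OF assms pq(2)] by simp
      then show False using add_step_neq[OF assms pq(2)] source[OF assms pq(2)] by simp
    qed
    then show ?thesis by blast
  qed
  moreover have "card ?A = k div 2"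
    using edge_at_inject assms card_S by (subst card_image) (auto intro!: inj_onI)
  moreover have "card ?B = k div 2"
    using edge_at_inject source[OF assms] card_S by (subst card_image) (auto intro!: inj_onI)
  ultimately show ?thesis
    using card_Un_disjoint[of ?A ?B] finite_S even_k by auto
qed

text \<open>Subscripts are lifted to integers so that translations by negative amounts are
  available.\<close>

definition pt :: "bool \<Rightarrow> int \<Rightarrow> nat \<times> bool" where
  "pt b m = (nat (m mod int n), b)"

definition rot :: "int \<Rightarrow> nat \<times> bool \<Rightarrow> nat \<times> bool" where
  "rot c v = pt (snd v) (int (fst v) + c)"

lemma pt_of_nat: "i < n \<Longrightarrow> pt b (int i) = (i, b)"
  by (simp add: pt_def)

lemma rot_pt: "rot c (pt b m) = pt b (m + c)"
  using n_pos by (simp add: rot_def pt_def mod_simps)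

lemma pt_verts: "pt b m \<in> verts G"
  using n_pos by (simp add: pt_def verts nat_less_iff)

lemma rot_verts: "rot c v \<in> verts G"
  by (simp add: rot_def pt_verts)

lemma pt_add_n: "pt b (m + int n) = pt b m"
  by (simp add: pt_def)

lemma edge_rot:
  assumes "e \<in> edges G"
  shows "\<exists>e'\<in>edges G. ends G e' = rot c ` ends G e"
  using assms
proof (rule edge_cases)
  fix j p b assume *: "j < n" "p \<in> S b" "ends G e = {(j, b), ((j + step p) mod n, b)}"
  define i where "i = nat ((int j + c) mod int n)"
  have i: "i < n" "int i = (int j + c) mod int n" using n_pos by (simp_all add: i_def nat_less_iff)
  have "int ((i + step p) mod n) = (int ((j + step p) mod n) + c) mod int n"
    using i(2) by (simp add: zmod_int mod_simps ac_simps)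
  then have "rot c ((j + step p) mod n, b) = ((i + step p) mod n, b)"
    by (simp add: rot_def pt_def)
  moreover have "rot c (j, b) = (i, b)" by (simp add: rot_def pt_def i_def)
  ultimately have "ends G (edge_at (i, p)) = rot c ` ends G e"
    using ends_edge_at[OF i(1) *(2)] *(3) by simp
  then show ?thesis using edge_at_edge[OF i(1) *(2)] by blast
qed

lemma path_rot: "path G u es v \<Longrightarrow> \<exists>fs. path G (rot c u) fs (rot c v)"
proof (induction es arbitrary: u)
  case Nil
  then show ?case using rot_verts by (intro exI[of _ "[]"]) auto
next
  case (Cons e es)
  then obtain x where x: "e \<in> edges G" "ends G e = {u, x}" "path G x es v" by auto
  obtain e' where "e' \<in> edges G" "ends G e' = {rot c u, rot c x}"
    using edge_rot[OF x(1), of c] x(2) by auto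
  moreover obtain fs where "path G (rot c x) fs (rot c v)" using Cons.IH[OF x(3)] by blast
  ultimately have "path G (rot c u) (e' # fs) (rot c v)" by (intro path_ConsI rot_verts)
  then show ?case by blast
qed

lemma path_sign: "path G u es v \<Longrightarrow> snd u = snd v"
proof (induction es arbitrary: u)
  case (Cons e es)
  then obtain x where x: "e \<in> edges G" "ends G e = {u, x}" "path G x es v" by auto
  from x(1) have "snd u = snd x"
    by (rule edge_cases) (use x(2) in \<open>auto simp: doubleton_eq_iff\<close>)
  then show ?case using Cons.IH[OF x(3)] by simp
qed simp

abbreviation K :: "bool \<Rightarrow> (nat \<times> bool, 'e) multigraph" where
  "K b \<equiv> component_of G (0, b)"

lemma K_verts_subset: "verts (K b) \<subseteq> {..<n} \<times> {b}"
proof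
  fix v assume "v \<in> verts (K b)"
  then obtain es where "path G (0, b) es v" unfolding verts_component_of by blast
  then show "v \<in> {..<n} \<times> {b}"
    using path_sign[of "(0, b)" es v] path_end_in_verts[of G "(0, b)" es v] verts
    by (auto simp: mem_Times_iff)
qed

lemma zero_in_K: "(0, b) \<in> verts (K b)"
  unfolding verts_component_of using verts n_pos by (auto intro: exI[of _ "[]"])

text \<open>The integers whose residue is reachable from 0 form a subgroup: translating paths from 0
  to \<open>x\<close> and from 0 to \<open>y\<close> by \<open>- y\<close> gives paths from
  \<open>- y\<close> to \<open>x - y\<close> and from \<open>- y\<close> to 0, and the second one
  reversed followed by the first leads from 0 to \<open>x - y\<close>. Periodicity puts
  \<open>n\<close> into the subgroup, so its generator divides \<open>n\<close>.\<close>

lemma K_subgroup: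
  obtains g where "0 < g" "g dvd n" "\<And>p. p \<in> S b \<Longrightarrow> g dvd step p"
    "verts (K b) = {i. i < n \<and> g dvd i} \<times> {b}"
proof -
  define H where "H = {m. pt b m \<in> verts (K b)}"
  have pt0: "pt b 0 = (0, b)" by (simp add: pt_def)
  have H_iff: "m \<in> H \<longleftrightarrow> (\<exists>es. path G (pt b 0) es (pt b m))" for m
    by (simp add: H_def verts_component_of pt0)
  have zero: "0 \<in> H" using zero_in_K by (simp add: H_def pt0)
  have diff: "x - y \<in> H" if xy: "x \<in> H" "y \<in> H" for x y
  proof -
    obtain es fs where "path G (pt b 0) es (pt b x)" "path G (pt b 0) fs (pt b y)"
      using xy unfolding H_iff by blast
    then obtain es' fs' where es': "path G (pt b (- y)) es' (pt b (x - y))"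
        and fs': "path G (pt b (- y)) fs' (pt b 0)"
      using path_rot[of "pt b 0" es "pt b x" "- y"] path_rot[of "pt b 0" fs "pt b y" "- y"]
      unfolding rot_pt by auto
    have "path G (pt b 0) (rev fs' @ es') (pt b (x - y))"
      unfolding path_append using es' path_rev[OF fs'] by blast
    then show ?thesis unfolding H_iff by blast
  qed
  have n: "int n \<in> H" using zero pt_add_n[of b 0] by (simp add: H_def)
  obtain g where g: "0 < g" "H = {m. int g dvd m}"
    using int_subgroup[OF zero diff n n_pos] by blast
  have "g dvd step p" if p: "p \<in> S b" for p
  proof -
    have "ends G (edge_at (0, p)) = {pt b 0, pt b (int (step p))}"
      using ends_edge_at[OF n_pos p] S_D[OF p] pt0 by (simp add: pt_of_nat)
    then have "path G (pt b 0) [edge_at (0, p)] (pt b (int (step p)))"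
      using path_single[OF pt_verts pt_verts edge_at_edge[OF n_pos p]] by blast
    then have "int (step p) \<in> H" unfolding H_iff by blast
    then show ?thesis using g by simp
  qed
  moreover have "verts (K b) = {i. i < n \<and> g dvd i} \<times> {b}"
  proof -
    have "(i, b) \<in> verts (K b) \<longleftrightarrow> g dvd i" if "i < n" for i
    proof -
      have "(i, b) \<in> verts (K b) \<longleftrightarrow> int i \<in> H" unfolding H_def by (simp add: pt_of_nat[OF that])
      then show ?thesis using g by simp
    qed
    then show ?thesis using K_verts_subset[of b] by (auto simp: set_eq_iff)
  qed
  moreover have "g dvd n" using n g by simp
  ultimately show ?thesis using that g(1) by blast
qed

lemma components_conv:
  assumes all: "\<And>b. verts (K b) = {..<n} \<times> {b}"
  shows "components G = range K" "card (components G) = 2"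
proof -
  have eq: "component_of G (i, b) = K b" if "i < n" for i b
  proof -
    have "(i, b) \<in> verts (K b)" using all that by simp
    then obtain es where "path G (0, b) es (i, b)" unfolding verts_component_of by blast
    then show ?thesis using component_of_eq by metis
  qed
  have "components G = (\<lambda>(i, b). K b) ` ({..<n} \<times> UNIV)"
    unfolding components_def verts
  proof (rule image_cong[OF refl])
    fix v :: "nat \<times> bool" assume "v \<in> {..<n} \<times> UNIV"
    then show "component_of G v = (case v of (i, b) \<Rightarrow> K b)"
      using eq[of "fst v" "snd v"] by (simp add: case_prod_beta mem_Times_iff)
  qed
  also have "\<dots> = range K"
  proof (intro equalityI subsetI)
    fix C assume "C \<in> range K"
    then obtain b where "C = K b" by blast
    then show "C \<in> (\<lambda>(i, b). K b) ` ({..<n} \<times> UNIV)"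
      using n_pos by (intro image_eqI[of _ _ "(0, b)"]) simp_all
  qed auto
  finally show range: "components G = range K" .
  have "inj K"
  proof (rule injI)
    fix b c assume "K b = K c"
    then have "(0, b) \<in> verts (K c)" using zero_in_K by metis
    then show "b = c" using all by simp
  qed
  then show "card (components G) = 2" unfolding range by (simp add: card_image)
qed

end

section \<open>From a component of diameter 2 and girth 4 to conditions on the steps\<close>

locale special_circulant_pair = circulant_pair +
  fixes b :: bool
  assumes bipartite: "bipartite (K b)" and diameter: "diameter (K b) = 2"
    and girth: "girth (K b) = 4"
begin

lemma no_parallel:
  assumes "e \<in> edges (K b)" "e' \<in> edges (K b)" "ends G e = ends G e'"
  shows "e = e'"
proof -
  obtain x y where xy: "ends G e = {x, y}"
    using edge_ends_verts[of e] assms(1) unfolding edges_component_of by blast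
  then have "x \<in> verts (K b)" "y \<in> verts (K b)"
    using assms(1) unfolding edges_component_of by auto
  then show ?thesis
    using girth_imp_no_parallel[of "K b" e e' x y] assms xy girth by simp
qed

text \<open>Diameter 2 makes the component complete bipartite and girth 4 makes it simple, so the
  degree of a vertex is the size of the opposite side. All degrees being \<open>k\<close>, both
  sides have \<open>k\<close> vertices.\<close>

lemma card_parts:
  obtains X Y where "X \<union> Y = verts (K b)" "X \<inter> Y = {}" "card X = k" "card Y = k"
    "\<And>x y. x \<in> verts (K b) \<Longrightarrow> y \<in> verts (K b) \<Longrightarrow>
       (\<exists>e\<in>edges (K b). ends G e = {x, y}) \<longleftrightarrow> (x \<in> X \<longleftrightarrow> y \<notin> X)"
proof -
  obtain X Y where XY: "X \<union> Y = verts (K b)" "X \<inter> Y = {}"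
    and e: "\<And>e. e \<in> edges (K b) \<Longrightarrow> \<exists>x\<in>X. \<exists>y\<in>Y. ends G e = {x, y}"
    using bipartite unfolding bipartite_def ends_component_of by metis
  have adj: "\<exists>e\<in>edges (K b). ends G e = {x, y}" if "x \<in> X" "y \<in> Y" for x y
    using diameter_two_imp_adjacent[of "K b" X Y x y] diameter XY e that
    unfolding ends_component_of by auto
  have inj: "inj_on (ends G) (edges (K b))"
    by (rule inj_onI) (rule no_parallel)
  have inc: "card {e \<in> edges (K b). v \<in> ends G e} = k" if v: "v \<in> verts (K b)" for v
  proof -
    obtain i where "v = (i, b)" "i < n" using K_verts_subset v by blast
    then show ?thesis using incident_component_of[OF v edge_ends_verts] card_incident by simp
  qed
  have cY: "card Y = k" if "x \<in> X" for x
    using card_incident_complete_bipartite[OF XY(2) e adj inj that] inc[of x] that XY by auto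
  have cX: "card X = k" if "y \<in> Y" for y
  proof -
    have "card {e \<in> edges (K b). y \<in> ends G e} = card X"
    proof (rule card_incident_complete_bipartite[of Y])
      show "Y \<inter> X = {}" using XY(2) by (simp add: Int_commute)
      show "\<exists>y\<in>Y. \<exists>x\<in>X. ends G f = {y, x}" if "f \<in> edges (K b)" for f
        using e[OF that] insert_commute by metis
      show "\<exists>e\<in>edges (K b). ends G e = {y, x}" if "x \<in> X" for x
        using adj[OF that \<open>y \<in> Y\<close>] by (simp add: insert_commute)
    qed (use inj that in auto)
    then show ?thesis using inc[of y] that XY(1) by auto
  qed
  \<comment> \<open>The size of a side is read off at a vertex of the opposite side. The vertex
    \<open>(0, b)\<close> gives one of the two sizes, and as \<open>k\<close> is positive there is
    then a vertex to give the other.\<close>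
  have "(0, b) \<in> X \<union> Y" using zero_in_K XY(1) by simp
  then have "card X = k" "card Y = k"
    using cX cY k_ge by (metis Un_iff all_not_in_conv card.empty not_numeral_le_zero)+
  moreover have "(\<exists>e\<in>edges (K b). ends G e = {x, y}) \<longleftrightarrow> (x \<in> X \<longleftrightarrow> y \<notin> X)"
    if "x \<in> verts (K b)" "y \<in> verts (K b)" for x y
  proof
    assume "\<exists>e\<in>edges (K b). ends G e = {x, y}"
    then obtain a a' where "a \<in> X" "a' \<in> Y" "{x, y} = {a, a'}" using e by metis
    then show "x \<in> X \<longleftrightarrow> y \<notin> X" using XY(2) by (auto simp: doubleton_eq_iff)
  next
    assume "x \<in> X \<longleftrightarrow> y \<notin> X"
    then show "\<exists>e\<in>edges (K b). ends G e = {x, y}"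
      using adj[of x y] adj[of y x] that XY(1) by (auto simp: insert_commute)
  qed
  ultimately show ?thesis using that XY by blast
qed

lemma card_K: "card (verts (K b)) = 2 * k"
proof -
  obtain X Y where "X \<union> Y = verts (K b)" "X \<inter> Y = {}" "card X = k" "card Y = k"
    using card_parts by metis
  moreover have "finite X" "finite Y" using calculation k_ge by (auto intro: card_ge_0_finite)
  ultimately show ?thesis using card_Un_disjoint[of X Y] by simp
qed

text \<open>The \<open>2 * k\<close> vertices are the multiples below \<open>n\<close> of a divisor
  \<open>g\<close> of \<open>n\<close>, and there are \<open>n div g\<close> of those.\<close>

lemma K_index:
  obtains g where "n = 2 * k * g" "\<And>p. p \<in> S b \<Longrightarrow> g dvd step p"
    "verts (K b) = {i. i < n \<and> g dvd i} \<times> {b}"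
proof -
  obtain g where g: "0 < g" "g dvd n" "\<And>p. p \<in> S b \<Longrightarrow> g dvd step p"
    "verts (K b) = {i. i < n \<and> g dvd i} \<times> {b}"
    by (rule K_subgroup[of b]) blast
  have "2 * k = n div g"
    using card_K card_multiples_below[OF g(1,2)] unfolding g(4) by (simp add: card_cartesian_product)
  then show ?thesis using that g by (metis dvd_div_mult_self)
qed

lemma edge_at_K:
  assumes "verts (K b) = {..<n} \<times> {b}" "j < n" "p \<in> S b"
  shows "edge_at (j, p) \<in> edges (K b)"
  unfolding edges_component_of assms(1) using assms n_pos edge_at_edge[OF assms(2,3)]
  by (simp add: ends_edge_at[OF assms(2,3)])

text \<open>Equal steps would give parallel edges starting at 0.\<close>

lemma inj_step:
  assumes all: "verts (K b) = {..<n} \<times> {b}"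
  shows "inj_on step (S b)"
proof (rule inj_onI)
  fix p q assume pq: "p \<in> S b" "q \<in> S b" "step p = step q"
  have "edge_at (0, p) = edge_at (0, q)"
    by (rule no_parallel[OF edge_at_K[OF all n_pos pq(1)] edge_at_K[OF all n_pos pq(2)]])
      (simp add: ends_edge_at[OF n_pos pq(1)] ends_edge_at[OF n_pos pq(2)] pq(3))
  then show "p = q" using edge_at_inject n_pos pq by blast
qed

text \<open>Otherwise the edge labelled \<open>p\<close> that starts at \<open>step q\<close>
  returns to 0 and is parallel to the edge labelled \<open>q\<close> that starts at 0. The starts
  differ, so this also covers \<open>p = q\<close>, a step of length \<open>n div 2\<close>.\<close>

lemma step_add_neq:
  assumes all: "verts (K b) = {..<n} \<times> {b}" and pq: "p \<in> S b" "q \<in> S b"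
  shows "step p + step q \<noteq> n"
proof
  assume eq: "step p + step q = n"
  have q: "step q < n" "0 < step q" using S_D[OF pq(2)] by blast+
  have "(step q + step p) mod n = 0" using eq by (simp add: add.commute)
  then have "ends G (edge_at (step q, p)) = ends G (edge_at (0, q))"
    using ends_edge_at[OF q(1) pq(1)] ends_edge_at[OF n_pos pq(2)] q(1)
    by (simp add: insert_commute)
  then have "edge_at (step q, p) = edge_at (0, q)"
    using no_parallel edge_at_K[OF all q(1) pq(1)] edge_at_K[OF all n_pos pq(2)] by blast
  then show False using edge_at_inject[of "step q" p 0 q b] n_pos q pq by simp
qed

text \<open>Colour the subscripts by their side. Adjacency means different colours and is invariant
  under translation, so whether \<open>i\<close> and \<open>Suc i\<close> differ in colour does not
  depend on \<open>i\<close>. If they agreed, the colouring would be constant and there would be no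
  edge; so the colours alternate, and the edge from 0 to \<open>step p\<close> makes
  \<open>step p\<close> odd.\<close>

lemma odd_step:
  assumes all: "verts (K b) = {..<n} \<times> {b}" and p: "p \<in> S b"
  shows "odd (step p)"
proof -
  obtain X Y where adj0: "\<And>x y. x \<in> verts (K b) \<Longrightarrow> y \<in> verts (K b) \<Longrightarrow>
       (\<exists>e\<in>edges (K b). ends G e = {x, y}) \<longleftrightarrow> (x \<in> X \<longleftrightarrow> y \<notin> X)"
    using card_parts by metis
  define c where "c i \<longleftrightarrow> (i, b) \<in> X" for i
  have adj: "(\<exists>e\<in>edges G. ends G e = {(i, b), (j, b)}) \<longleftrightarrow> c i \<noteq> c j" if "i < n" "j < n" for i j
    using adj0[of "(i, b)" "(j, b)"] that all unfolding edges_component_of c_def by auto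
  have shift: "c (nat ((int i + d) mod int n)) \<noteq> c (nat ((int j + d) mod int n))"
    if ij: "i < n" "j < n" "c i \<noteq> c j" for i j d
  proof -
    obtain e where e: "e \<in> edges G" "ends G e = {(i, b), (j, b)}" using adj[of i j] ij by blast
    obtain e' where e': "e' \<in> edges G" "ends G e' = {rot d (i, b), rot d (j, b)}"
      using edge_rot[OF e(1), of d] e(2) by auto
    have lt: "nat ((int m + d) mod int n) < n" for m using n_pos by (simp add: nat_less_iff)
    show ?thesis using adj[OF lt lt, of i j] e' unfolding rot_def pt_def by auto
  qed
  have step: "step p < n" "0 < step p" using S_D[OF p] by auto
  have c_step: "c 0 \<noteq> c (step p)"
    using adj[OF n_pos step(1)] edge_at_edge[OF n_pos p] ends_edge_at[OF n_pos p] step by auto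
  have c_Suc: "c i \<noteq> c (Suc i) \<longleftrightarrow> c 0 \<noteq> c 1" if "Suc i < n" for i
  proof
    assume "c i \<noteq> c (Suc i)"
    then show "c 0 \<noteq> c 1" using shift[of i "Suc i" "- int i"] that by simp
  next
    assume "c 0 \<noteq> c 1"
    then show "c i \<noteq> c (Suc i)"
      using shift[of 0 1 "int i"] that by (simp add: nat_mod_distrib nat_add_distrib)
  qed
  have "c 0 \<noteq> c 1"
  proof
    assume "c 0 = c 1"
    then have "c i = c 0" if "i < n" for i
      using that c_Suc by (induction i) auto
    then show False using c_step step by blast
  qed
  then have "c i = (c 0 = even i)" if "i < n" for i
    using that c_Suc by (induction i) auto
  from this[OF step(1)] c_step show ?thesis by blast
qed

end

context circulant_pair
begin

text \<open>The indices of the two components agree because both satisfy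
  \<open>n = 2 * k * g\<close>. The common index divides all steps of both signs, so
  \<open>irr\<close> makes it 1.\<close>

lemma special_imp:
  assumes irr: "\<And>g. g dvd n \<Longrightarrow> (\<And>p. p < k \<Longrightarrow> g dvd step p) \<Longrightarrow> g = 1"
    and special: "\<And>b. bipartite (K b)" "\<And>b. diameter (K b) = 2" "\<And>b. girth (K b) = 4"
  shows "n = 2 * k" "card (components G) = 2" "inj_on step (S b)"
    "p \<in> S b \<Longrightarrow> odd (step p)" "p \<in> S b \<Longrightarrow> q \<in> S b \<Longrightarrow> step p + step q \<noteq> n"
proof -
  have loc: "special_circulant_pair n k sign step G edge_at b" for b
    by unfold_locales (use special in auto)
  have "\<exists>g. n = 2 * k * g \<and> (\<forall>p\<in>S b. g dvd step p) \<and> verts (K b) = {i. i < n \<and> g dvd i} \<times> {b}" for b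
    by (rule special_circulant_pair.K_index[OF loc[of b]]) blast
  then obtain g where g: "\<And>b. n = 2 * k * g b" "\<And>b p. p \<in> S b \<Longrightarrow> g b dvd step p"
      "\<And>b. verts (K b) = {i. i < n \<and> g b dvd i} \<times> {b}"
    by metis
  have g_eq: "g b = g True" for b using g(1)[of b] g(1)[of True] k_ge by simp
  have "g True = 1"
  proof (rule irr)
    show "g True dvd n" using g(1)[of True] by simp
    show "g True dvd step p" if "p < k" for p
      using g(2)[of p "sign p"] g_eq[of "sign p"] that by (simp add: S_def)
  qed
  then have g1: "g b = 1" for b using g_eq by simp
  then have all: "verts (K b) = {..<n} \<times> {b}" for b using g(3) by auto
  show "n = 2 * k" using g(1)[of True] g1 by simp
  show "card (components G) = 2" using components_conv[OF all] by blast
  show "inj_on step (S b)" using special_circulant_pair.inj_step[OF loc all] .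
  show "p \<in> S b \<Longrightarrow> odd (step p)" using special_circulant_pair.odd_step[OF loc all] .
  show "p \<in> S b \<Longrightarrow> q \<in> S b \<Longrightarrow> step p + step q \<noteq> n"
    using special_circulant_pair.step_add_neq[OF loc all] .
qed

end

section \<open>From the conditions on the steps back to complete bipartite components\<close>

locale odd_circulant_pair = circulant_pair +
  assumes n_eq: "n = 2 * k" and inj_step: "\<And>b. inj_on step (S b)"
    and odd_step: "\<And>b p. p \<in> S b \<Longrightarrow> odd (step p)"
    and step_add_neq: "\<And>b p q. p \<in> S b \<Longrightarrow> q \<in> S b \<Longrightarrow> step p + step q \<noteq> n"
begin

lemma odd_mod_n: "odd (m mod n) \<longleftrightarrow> odd m"
  using dvd_mod_iff[of 2 n m] n_eq by simp

text \<open>Counting: the \<open>k div 2\<close> steps and their \<open>k div 2\<close> complements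
  to \<open>n\<close> are disjoint sets of odd numbers below \<open>2 * k\<close>, and there are
  only \<open>k\<close> such numbers.\<close>

lemma odd_cases:
  assumes "odd d" "d < n"
  shows "\<exists>p\<in>S b. d = step p \<or> d + step p = n"
proof -
  let ?A = "step ` S b" and ?B = "(\<lambda>p. n - step p) ` S b"
  have "inj_on (\<lambda>p. n - step p) (S b)"
  proof (rule inj_onI)
    fix p q assume pq: "p \<in> S b" "q \<in> S b" "n - step p = n - step q"
    then have "step p = step q" using S_D[OF pq(1)] S_D[OF pq(2)] by linarith
    then show "p = q" using inj_step[of b] pq by (auto simp: inj_on_def)
  qed
  then have "card ?A = k div 2" "card ?B = k div 2"
    using inj_step card_S by (simp_all add: card_image)
  moreover have "?A \<inter> ?B = {}"
  proof -
    have False if "p \<in> S b" "q \<in> S b" "step p = n - step q" for p q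
      using step_add_neq[OF that(1,2)] that(3) S_D[OF that(2)] by simp
    then show ?thesis by blast
  qed
  ultimately have "card (?A \<union> ?B) = k"
    using card_Un_disjoint[of ?A ?B] finite_S even_k by auto
  moreover have sub: "?A \<union> ?B \<subseteq> (\<lambda>m. 2 * m + 1) ` {..<k}"
  proof
    fix x assume "x \<in> ?A \<union> ?B"
    then obtain p where p: "p \<in> S b" "x = step p \<or> x = n - step p" by blast
    have "odd (step p)" "0 < step p" "step p < n" using odd_step p(1) S_D by blast+
    then have "odd x \<and> x < 2 * k" using p(2) n_eq by auto
    then show "x \<in> (\<lambda>m. 2 * m + 1) ` {..<k}" by (auto elim!: oddE)
  qed
  moreover have "card ((\<lambda>m::nat. 2 * m + 1) ` {..<k}) = k"
    by (subst card_image) (auto simp: inj_on_def)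
  ultimately have eq: "?A \<union> ?B = (\<lambda>m. 2 * m + 1) ` {..<k}"
    by (intro card_subset_eq) auto
  have "d \<in> (\<lambda>m. 2 * m + 1) ` {..<k}" using assms n_eq by (auto elim!: oddE)
  then have "d \<in> ?A \<union> ?B" using eq by simp
  then obtain p where p: "p \<in> S b" "d = step p \<or> d = n - step p" by blast
  then have "d = step p \<or> d + step p = n" using S_D[OF p(1)] by auto
  then show ?thesis using p(1) by blast
qed

lemma adjacent:
  assumes ij: "i < n" "j < n" "odd (i + j)"
  shows "\<exists>e\<in>edges G. ends G e = {(i, b), (j, b)}"
proof -
  \<comment> \<open>By symmetry \<open>i < j\<close> may be assumed, which makes
    \<open>j - i\<close> a true difference.\<close>
  have *: "\<exists>e\<in>edges G. ends G e = {(i, b), (j, b)}"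
    if ij: "i < n" "j < n" "odd (i + j)" "i < j" for i j
  proof -
    have "odd (j - i)" "j - i < n" using ij by auto
    then obtain p where p: "p \<in> S b" "j - i = step p \<or> j - i + step p = n"
      using odd_cases by metis
    then show ?thesis
    proof (elim disjE)
      assume "j - i = step p"
      then have "(i + step p) mod n = j" using ij by auto
      then show ?thesis
        using ends_edge_at[OF ij(1) p(1)] edge_at_edge[OF ij(1) p(1)] by auto
    next
      assume "j - i + step p = n"
      then have "j + step p = i + n" using ij by simp
      then have "(j + step p) mod n = i" using ij by simp
      then show ?thesis
        using ends_edge_at[OF ij(2) p(1)] edge_at_edge[OF ij(2) p(1)] by (auto simp: insert_commute)
    qed
  qed
  show ?thesis
  proof (cases "i < j")
    case True
    then show ?thesis using * ij by blast
  next
    case False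
    then have "j < i" using ij(3) by (cases "i = j") auto
    then show ?thesis using *[OF ij(2,1)] ij(3) by (simp add: insert_commute add.commute)
  qed
qed

text \<open>Orients the edge so that the even subscript comes first; the even and the odd subscripts
  become the two sides.\<close>

lemma edge_parity:
  assumes "e \<in> edges G"
  obtains b i j where "i < n" "j < n" "even i" "odd j" "ends G e = {(i, b), (j, b)}"
  using assms
proof (rule edge_cases)
  fix i p b assume *: "i < n" "p \<in> S b" "ends G e = {(i, b), ((i + step p) mod n, b)}"
  let ?j = "(i + step p) mod n"
  have "?j < n" using n_pos by simp
  moreover have "odd ?j \<longleftrightarrow> even i" using odd_step[OF *(2)] by (simp add: odd_mod_n)
  ultimately show ?thesis
    using that[of i ?j b] that[of ?j i b] * by (cases "even i") (auto simp: insert_commute)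
qed

text \<open>Edges with the same ends either run in the same direction and have equal steps, or run
  in opposite directions and have steps adding up to a multiple of \<open>n\<close>.\<close>

lemma inj_ends: "inj_on (ends G) (edges G)"
proof (rule inj_onI)
  fix e f assume ef: "e \<in> edges G" "f \<in> edges G" "ends G e = ends G f"
  obtain i p b where e: "i < n" "p \<in> S b" "e = edge_at (i, p)"
    "ends G e = {(i, b), ((i + step p) mod n, b)}"
    by (rule edge_cases[OF ef(1)])
  obtain j q c where f: "j < n" "q \<in> S c" "f = edge_at (j, q)"
    "ends G f = {(j, c), ((j + step q) mod n, c)}"
    by (rule edge_cases[OF ef(2)])
  have c: "c = b" using ef(3) unfolding e(4) f(4) doubleton_eq_iff prod.inject by blast
  have p: "step p < n" "0 < step p" and q: "step q < n" "0 < step q"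
    using S_D[OF e(2)] S_D[OF f(2)] by auto
  have "i = j \<and> (i + step p) mod n = (j + step q) mod n \<or>
      i = (j + step q) mod n \<and> j = (i + step p) mod n"
    using ef(3) unfolding e(4) f(4) doubleton_eq_iff prod.inject by metis
  then show "e = f"
  proof (elim disjE conjE)
    assume "i = j" "(i + step p) mod n = (j + step q) mod n"
    then have "step p = step q"
      using mod_add_right_cancel[of "step p" i n "step q"] p q by (simp add: add.commute)
    then have "p = q" using inj_step[of b] p q e(2) f(2) c by (auto simp: inj_on_def)
    then show ?thesis using \<open>i = j\<close> e f by simp
  next
    assume "i = (j + step q) mod n" "j = (i + step p) mod n"
    then have "(i + (step p + step q)) mod n = i mod n"
      using e(1) by (metis add.assoc mod_add_left_eq mod_less)
    then have "n dvd step p + step q"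
      by (metis add_diff_cancel_left' le_add1 mod_eq_dvd_iff_nat)
    \<comment> \<open>The sum of the two steps lies strictly between 0 and \<open>2 * n\<close>, so
      the multiple can only be \<open>n\<close>.\<close>
    then obtain m where m: "step p + step q = n * m" by blast
    then have "n * m < n * 2" "n * m > n * 0" using p q by linarith+
    then have "m = 1" unfolding mult_less_cancel1 by linarith
    then show ?thesis using m step_add_neq[OF e(2)] f(2) c by auto
  qed
qed

lemma verts_K: "verts (K b) = {..<n} \<times> {b}"
proof -
  have v: "(i, b) \<in> verts G" if "i < n" for i using that verts by simp
  have n4: "1 < n" using n_eq k_ge by simp
  have edge: "\<exists>es. path G (i, b) es (j, b)" if ij: "i < n" "j < n" "odd (i + j)" for i j
  proof -
    obtain e where "e \<in> edges G" "ends G e = {(i, b), (j, b)}" using adjacent[OF ij] by metis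
    then have "path G (i, b) [e] (j, b)" using path_single v ij by metis
    then show ?thesis by blast
  qed
  \<comment> \<open>An odd subscript is adjacent to 0; an even one, 0 included, is reached through
    the vertex 1.\<close>
  have "\<exists>es. path G (0, b) es (i, b)" if i: "i < n" for i
  proof (cases "even i")
    case True
    then obtain es fs where "path G (0, b) es (1, b)" "path G (1, b) fs (i, b)"
      using edge[of 0 1] edge[of 1 i] n_pos n4 i by auto
    then have "path G (0, b) (es @ fs) (i, b)" unfolding path_append by blast
    then show ?thesis by blast
  next
    case False
    then show ?thesis using edge[of 0 i] n_pos i by simp
  qed
  then have "(i, b) \<in> verts (K b)" if "i < n" for i
    using that unfolding verts_component_of by blast
  then show ?thesis using K_verts_subset[of b] by auto
qed

lemma K_edges: "edges (K b) = {e \<in> edges G. ends G e \<subseteq> {..<n} \<times> {b}}"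
  using verts_K[of b] by (simp add: edges_component_of)

lemmas components_eq = components_conv(1)[OF verts_K]
  and card_components = components_conv(2)[OF verts_K]

lemma K_graph:
  "connected_graph (K b)" "bipartite (K b)" "diameter (K b) = 2" "girth (K b) = 4"
proof -
  let ?X = "{i. i < n \<and> even i} \<times> {b}" and ?Y = "{i. i < n \<and> odd i} \<times> {b}"
  have 1: "verts (K b) = ?X \<union> ?Y" using verts_K by auto
  have 2: "?X \<inter> ?Y = {}" by auto
  have 3: "\<exists>x\<in>?X. \<exists>y\<in>?Y. ends (K b) e = {x, y}" if e: "e \<in> edges (K b)" for e
  proof -
    have "e \<in> edges G" "ends G e \<subseteq> {..<n} \<times> {b}" using e unfolding K_edges by auto
    then show ?thesis by (elim edge_parity) auto
  qed
  have 4: "\<exists>e\<in>edges (K b). ends (K b) e = {x, y}" if xy: "x \<in> ?X" "y \<in> ?Y" for x y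
  proof -
    obtain e where "e \<in> edges G" "ends G e = {x, y}"
      using adjacent[of "fst x" "fst y" b] xy by auto
    then show ?thesis using xy unfolding K_edges ends_component_of by auto
  qed
  have 5: "inj_on (ends (K b)) (edges (K b))"
    using inj_ends unfolding K_edges ends_component_of by (auto simp: inj_on_def)
  have 6: "(0, b) \<in> ?X" "(2, b) \<in> ?X" "(0 :: nat, b) \<noteq> (2, b)"
    "(1, b) \<in> ?Y" "(3, b) \<in> ?Y" "(1 :: nat, b) \<noteq> (3, b)"
    using n_eq k_ge by auto
  show "connected_graph (K b)" "bipartite (K b)" "diameter (K b) = 2" "girth (K b) = 4"
    using complete_bipartite[OF 1 2 3 4 5 6] by blast+
qed

lemma ends_K_image: "ends G ` edges (K b) = {{(i, b), (j, b)} | i j. i < n \<and> j < n \<and> odd (i + j)}"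
proof (intro equalityI subsetI)
  fix x assume "x \<in> ends G ` edges (K b)"
  then obtain e where e: "e \<in> edges G" "ends G e \<subseteq> {..<n} \<times> {b}" "x = ends G e"
    unfolding K_edges by auto
  from e(1) show "x \<in> {{(i, b), (j, b)} | i j. i < n \<and> j < n \<and> odd (i + j)}"
  proof (rule edge_parity)
    fix c i j assume *: "i < n" "j < n" "even i" "odd j" "ends G e = {(i, c), (j, c)}"
    then have "c = b" using e(2) by auto
    then show ?thesis using * e(3) by auto
  qed
next
  fix x assume "x \<in> {{(i, b), (j, b)} | i j. i < n \<and> j < n \<and> odd (i + j)}"
  then obtain i j where x: "x = {(i, b), (j, b)}" "i < n" "j < n" "odd (i + j)" by blast
  obtain e where "e \<in> edges G" "ends G e = x" using adjacent[OF x(2-4)] x(1) by metis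
  moreover have "x \<subseteq> {..<n} \<times> {b}" using x by auto
  ultimately show "x \<in> ends G ` edges (K b)" unfolding K_edges by auto
qed

text \<open>Changing the sign of the vertices carries one family of end sets onto the other, since
  in both graphs the end sets are all pairs of subscripts of different parity.\<close>

lemma isomorphic_K: "isomorphic (K b) (K c)"
proof (rule isomorphic_simple)
  let ?f = "\<lambda>v. (fst v, c)"
  show "bij_betw ?f (verts (K b)) (verts (K c))"
    unfolding verts_K by (auto simp: bij_betw_def inj_on_def image_iff)
  have inj: "inj_on (ends (K d)) (edges (K d))" for d
    using inj_ends unfolding K_edges ends_component_of by (auto simp: inj_on_def)
  show "inj_on (ends (K b)) (edges (K b))" "inj_on (ends (K c)) (edges (K c))" by (rule inj)+
  show "ends (K b) e \<subseteq> verts (K b)" if "e \<in> edges (K b)" for e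
    using that by (simp add: edges_component_of)
  have "(\<lambda>e. ?f ` ends (K b) e) ` edges (K b) = image ?f ` (ends G ` edges (K b))"
    unfolding ends_component_of by (simp add: image_image)
  also have "\<dots> = {{(i, c), (j, c)} | i j. i < n \<and> j < n \<and> odd (i + j)}"
  proof (intro equalityI subsetI)
    fix x assume "x \<in> image ?f ` (ends G ` edges (K b))"
    then obtain i j where "x = ?f ` {(i, b), (j, b)}" "i < n" "j < n" "odd (i + j)"
      unfolding ends_K_image by blast
    then show "x \<in> {{(i, c), (j, c)} | i j. i < n \<and> j < n \<and> odd (i + j)}" by auto
  next
    fix x assume "x \<in> {{(i, c), (j, c)} | i j. i < n \<and> j < n \<and> odd (i + j)}"
    then obtain i j where *: "x = {(i, c), (j, c)}" "i < n" "j < n" "odd (i + j)" by blast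
    have "{(i, b), (j, b)} \<in> ends G ` edges (K b)" unfolding ends_K_image using * by blast
    moreover have "x = ?f ` {(i, b), (j, b)}" using * by simp
    ultimately show "x \<in> image ?f ` (ends G ` edges (K b))" by (rule image_eqI[rotated])
  qed
  also have "\<dots> = ends (K c) ` edges (K c)"
    unfolding ends_component_of ends_K_image ..
  finally show "(\<lambda>e. ?f ` ends (K b) e) ` edges (K b) = ends (K c) ` edges (K c)" .
qed

lemma degree_K:
  assumes "v \<in> verts (K b)" shows "degree (K b) v \<ge> 3"
proof -
  obtain i where v: "v = (i, b)" "i < n" using assms unfolding verts_K by auto
  have "card {e \<in> edges (K b). v \<in> ends G e} = k"
    using incident_component_of[OF assms edge_ends_verts] card_incident[OF v(2)] v(1) by simp
  then show ?thesis using k_ge unfolding degree_def ends_component_of by simp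
qed

end

section \<open>The star graph of an alternating cyclic presentation\<close>

definition shift :: "nat \<Rightarrow> nat \<Rightarrow> nat letter \<Rightarrow> nat letter" where
  "shift n i = (\<lambda>(j, s). ((j + i) mod n, s))"

lemma shift_linv: "shift n i (linv p) = linv (shift n i p)"
  by (simp add: shift_def linv_def case_prod_beta)

lemma snd_shift [simp]: "snd (shift n i p) = snd p"
  by (simp add: shift_def case_prod_beta)

lemma fst_shift [simp]: "fst (shift n i p) = (fst p + i) mod n"
  by (simp add: shift_def case_prod_beta)

lemma shift_eq_iff:
  "fst p < n \<Longrightarrow> fst q < n \<Longrightarrow> shift n i p = shift n i q \<longleftrightarrow> p = q"
  using mod_add_right_cancel[of "fst p" i n "fst q"] by (auto simp: prod_eq_iff)

lemma theta_power:
  assumes "\<And>l. l \<in> set w \<Longrightarrow> fst l < n"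
  shows "(theta n ^^ i) w = map (shift n i) w"
proof (induction i)
  case 0
  show ?case using assms by (auto simp: shift_def intro!: map_idI[symmetric])
next
  case (Suc i)
  then show ?case
    by (auto simp: theta_def shift_def mod_Suc_eq mod_simps)
qed

text \<open>Indices modulo the length put the wrap-around pair on the same footing as the others, in
  the form in which signs and steps are treated below.\<close>

lemma cyclically_reduced_conv_nth:
  assumes "u \<noteq> []"
  shows "cyclically_reduced u \<longleftrightarrow>
    (\<forall>p<length u. u ! (Suc p mod length u) \<noteq> linv (u ! p))" (is "?L = ?R")
proof -
  obtain m where m: "length u = Suc m" using assms by (cases u) auto
  have "?R \<longleftrightarrow> (\<forall>p<m. u ! Suc p \<noteq> linv (u ! p)) \<and> u ! 0 \<noteq> linv (u ! m)"
  proof -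
    have "Suc p mod Suc m = Suc p" if "p < m" for p using that by simp
    then show ?thesis unfolding m by (auto simp: less_Suc_eq)
  qed
  moreover have "hd u = u ! 0" "last u = u ! m"
    using assms m by (auto simp: hd_conv_nth last_conv_nth)
  ultimately show ?thesis
    using assms m by (auto simp: cyclically_reduced_def reduced_def successively_conv_nth)
qed

section \<open>Rotations and inverses of words in the free group\<close>

lemma length_winv [simp]: "length (winv u) = length u"
  by (simp add: winv_def)

lemma linv_comp_linv [simp]: "linv \<circ> linv = id"
  by (simp add: fun_eq_iff)

lemma winv_winv [simp]: "winv (winv u) = u"
  by (simp add: winv_def rev_map)

lemma winv_append: "winv (u @ v) = winv v @ winv u"
  by (simp add: winv_def)

lemma winv_rotate: "\<exists>j. winv (rotate i u) = rotate j (winv u)"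
proof -
  have "rotate i u = drop (i mod length u) u @ take (i mod length u) u"
    by (rule rotate_drop_take)
  then have "winv (rotate i u) =
      rotate (length (winv (drop (i mod length u) u))) (winv u)"
    by (metis append_take_drop_id rotate_append winv_append)
  then show ?thesis by blast
qed

lemma rotate_eq_swap:
  assumes "rotate i u = rotate j v"
  shows "\<exists>t. u = rotate t v"
proof (cases "u = []")
  case True
  then show ?thesis using assms by (metis rotate_is_Nil_conv)
next
  case False
  \<comment> \<open>The total rotation is by \<open>i * length u\<close>, hence trivial; the
    subtraction is not truncated because \<open>u\<close> is nonempty.\<close>
  have "rotate (i * length u - i) (rotate i u) = u"
    using False by (simp add: rotate_rotate rotate_id mult_le_mono2 Suc_leI)
  then show ?thesis unfolding assms by (metis rotate_rotate)
qed

lemma rotate_reduce_index: "\<exists>j<length u. rotate i u = rotate j u" if "u \<noteq> []"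
  using that by (intro exI[of _ "i mod length u"]) (simp flip: rotate_conv_mod)

text \<open>Reduces the pairing of words in an edge to inversion: flipping a rotation of a relator
  gives a rotation of the inverse relator.\<close>

lemma flip_conv_rotate:
  assumes "length z \<ge> 2"
  shows "flip z = rotate (length z - 2) (winv z)"
proof -
  obtain p q u where z: "z = p # q # u" using assms by (cases z rule: flip.cases) auto
  have "winv z = winv u @ [linv q, linv p]" by (simp add: z winv_def)
  moreover have "length (winv u) = length z - 2" by (simp add: z)
  ultimately show ?thesis using z rotate_append[of "winv u" "[linv q, linv p]"] by simp
qed

lemma flip_flip: "length z \<ge> 2 \<Longrightarrow> flip (flip z) = z"
  by (cases z rule: flip.cases) auto

lemma reduced_appendD: "reduced (u @ v) \<Longrightarrow> reduced u \<and> reduced v"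
  by (auto simp: reduced_def successively_append_iff)

text \<open>If \<open>s = b @ a\<close> and \<open>r = a @ b\<close>, then \<open>a\<close>
  conjugates \<open>s\<close> to \<open>r\<close>. Both words being reduced, these concatenations
  are products in the free group.\<close>

lemma freely_conjugate_rotate:
  assumes r: "r \<in> carrier (free_group X)" and s: "s \<in> carrier (free_group X)"
    and "r = rotate t s"
  shows "freely_conjugate X r s"
proof -
  interpret group "free_group X" by (rule group_free_group)
  define a b where "a = drop (t mod length s) s" and "b = take (t mod length s) s"
  have rs: "r = a @ b" "s = b @ a"
    using assms(3) by (simp_all add: a_def b_def rotate_drop_take)
  have ab: "a \<in> carrier (free_group X)" "b \<in> carrier (free_group X)"
    using s reduced_appendD[of b a] unfolding rs by (auto simp: free_group_def)
  have "r = a \<otimes>\<^bsub>free_group X\<^esub> b" "s = b \<otimes>\<^bsub>free_group X\<^esub> a"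
    using r s unfolding rs by (auto simp: free_group_def reduce_reduced)
  then have "r = a \<otimes>\<^bsub>free_group X\<^esub> s \<otimes>\<^bsub>free_group X\<^esub> inv\<^bsub>free_group X\<^esub> a"
    using ab by (simp add: m_assoc)
  then show ?thesis using ab unfolding freely_conjugate_def by blast
qed

lemma free_group_pow:
  assumes "v \<in> carrier (free_group X)"
  shows "v [^]\<^bsub>free_group X\<^esub> (t::nat) = reduce (concat (replicate t v))"
proof (induction t)
  case 0
  then show ?case by (simp add: free_group_def nat_pow_def reduce_def)
next
  case (Suc t)
  interpret group "free_group X" by (rule group_free_group)
  have "v [^]\<^bsub>free_group X\<^esub> Suc t = reduce (concat (replicate t v)) \<otimes>\<^bsub>free_group X\<^esub> v"
    using Suc by simp
  also have "\<dots> = reduce (concat (replicate t v) @ v)"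
    by (simp add: free_group_def reduce_reduce_append)
  also have "concat (replicate t v) @ v = concat (replicate (Suc t) v)"
    by (metis concat.simps concat_append append_Nil2 replicate_append_same replicate_Suc)
  finally show ?case .
qed

text \<open>The two pieces into which \<open>d\<close> cuts \<open>w\<close> commute as words, so
  they are powers of a common word \<open>zs\<close>. Both pieces are nonempty, so the exponents add
  up to at least 2; \<open>zs\<close> is reduced as a prefix of \<open>w\<close>.\<close>

lemma rotate_fixed_imp_proper_power:
  assumes w: "w \<in> carrier (free_group X)" and "rotate d w = w" "0 < d" "d < length w"
  shows "proper_power X w"
proof -
  define a b where "a = drop d w" and "b = take d w"
  have ne: "a \<noteq> []" "b \<noteq> []" using assms by (auto simp: a_def b_def)
  have w_eq: "w = b @ a" "w = a @ b"
    using assms by (simp_all add: a_def b_def rotate_drop_take)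
  then obtain m m' zs where z: "concat (replicate m zs) = a" "concat (replicate m' zs) = b"
    using comm_append_are_replicate[of a b] by metis
  have "m \<noteq> 0" "m' \<noteq> 0" using z ne by (metis concat.simps(1) replicate_0)+
  then obtain m1 where m: "m = Suc m1" by (cases m) auto
  have wz: "w = concat (replicate (m + m') zs)"
    using w_eq z by (simp add: replicate_add)
  have "w = zs @ concat (replicate (m1 + m') zs)" using wz m by simp
  then have "zs \<in> carrier (free_group X)"
    using w by (auto simp: free_group_def dest: reduced_appendD)
  moreover have "w = reduce w" using w by (simp add: free_group_def reduce_reduced)
  ultimately show ?thesis
    using wz \<open>m \<noteq> 0\<close> \<open>m' \<noteq> 0\<close> unfolding proper_power_def
    by (intro bexI[of _ zs] exI[of _ "m + m'"]) (auto simp: free_group_pow)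
qed

section \<open>Signs, steps and shifts of an alternating word\<close>

locale alternating_word =
  fixes n k :: nat and w :: "nat word"
  assumes w: "w \<in> carrier (F n)" and cyclically_reduced: "cyclically_reduced w"
    and alternating: "alternating w" and length: "length w = k"
    and even_k: "even k" and k_ge: "k \<ge> 4"
begin

lemma fst_less: "l \<in> set w \<Longrightarrow> fst l < n"
  using w by (auto simp: free_group_def)

lemma nth_less: "p < k \<Longrightarrow> fst (w ! p) < n"
  using fst_less length by simp

lemma n_pos: "0 < n"
  using nth_less[of 0] k_ge by simp

lemma Suc_mod_less [simp]: "Suc p mod k < k"
  using k_ge by simp

lemma nth_succ: "p < k \<Longrightarrow> w ! (Suc p mod k) \<noteq> linv (w ! p)"
  using cyclically_reduced_conv_nth[of w] cyclically_reduced length k_ge by fastforce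

lemma cyclic_pairs_conv: "cyclic_pairs w = map (\<lambda>p. (w ! p, w ! (Suc p mod k))) [0..<k]"
  by (rule nth_equalityI) (simp_all add: cyclic_pairs_def length nth_rotate1)

lemma sign_succ: "p < k \<Longrightarrow> snd (w ! (Suc p mod k)) \<longleftrightarrow> \<not> snd (w ! p)"
proof -
  assume "p < k"
  then have "(w ! p, w ! (Suc p mod k)) \<in> set (cyclic_pairs w)"
    by (auto simp: cyclic_pairs_conv)
  then show ?thesis
    using alternating unfolding alternating_def
    by (metis (full_types) prod.collapse)
qed

lemma sign_nth: "p < k \<Longrightarrow> snd (w ! p) \<longleftrightarrow> (snd (w ! 0) \<longleftrightarrow> even p)"
proof (induction p)
  case (Suc p)
  then show ?case using sign_succ[of p] by auto
qed simp

definition sgn_set :: "bool \<Rightarrow> nat set" where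
  "sgn_set b = {p. p < k \<and> snd (w ! p) = b}"

text \<open>The entry that position \<open>p\<close> contributes to \<A> or \<B>, according to the
  sign of the letter there.\<close>

definition step :: "nat \<Rightarrow> nat" where
  "step p = (fst (w ! (Suc p mod k)) + n - fst (w ! p)) mod n"

text \<open>By alternation the cyclic successor maps the positions of either sign injectively into
  those of the other.\<close>

lemma card_sgn_set: "card (sgn_set b) = k div 2"
proof -
  have inj: "inj_on (\<lambda>p. Suc p mod k) (sgn_set c)" for c
  proof (rule inj_onI)
    fix p q assume "p \<in> sgn_set c" "q \<in> sgn_set c" "Suc p mod k = Suc q mod k"
    then show "p = q"
      using mod_add_right_cancel[of p 1 k q] by (auto simp: sgn_set_def)
  qed
  have fin: "finite (sgn_set c)" for c by (simp add: sgn_set_def)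
  have sub: "(\<lambda>p. Suc p mod k) ` sgn_set c \<subseteq> sgn_set (\<not> c)" for c
    by (auto simp: sgn_set_def sign_succ)
  have le: "card (sgn_set c) \<le> card (sgn_set (\<not> c))" for c
    using card_inj_on_le[OF inj sub fin] .
  have eq: "card (sgn_set True) = card (sgn_set False)"
    using le[of True] le[of False] by simp
  have "{..<k} = sgn_set True \<union> sgn_set False" "sgn_set True \<inter> sgn_set False = {}"
    by (auto simp: sgn_set_def)
  then have "k = card (sgn_set True) + card (sgn_set False)"
    using card_Un_disjoint[OF fin fin] by (metis card_lessThan)
  then show ?thesis using eq by (cases b) auto
qed

lemma step_less: "step p < n"
  using n_pos by (simp add: step_def)

lemma step_add: "p < k \<Longrightarrow> (fst (w ! p) + step p) mod n = fst (w ! (Suc p mod k))"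
  using nth_less[of p] nth_less[of "Suc p mod k"]
  unfolding step_def mod_add_right_eq by simp

text \<open>A step of 0 would put a letter next to its inverse, the signs being opposite.\<close>

lemma step_pos: "p < k \<Longrightarrow> 0 < step p"
proof (rule ccontr)
  assume p: "p < k" "\<not> 0 < step p"
  then have "fst (w ! p) = fst (w ! (Suc p mod k))"
    using step_add[of p] nth_less[of p] by simp
  then have "w ! (Suc p mod k) = linv (w ! p)"
    using sign_succ[of p] p by (auto simp: linv_def prod_eq_iff)
  then show False using nth_succ p by blast
qed

lemma mset_A_conv: "mset_A n w = image_mset step (mset_set (sgn_set True))"
  and mset_B_conv: "mset_B n w = image_mset step (mset_set (sgn_set False))"
proof -
  \<comment> \<open>Alternation turns the filter on pairs of signs into a filter on the first
    position.\<close>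
  have eq: "{p. p < k \<and> snd (w ! p) = b \<and> snd (w ! (Suc p mod k)) \<noteq> b} = sgn_set b" for b
    by (auto simp: sgn_set_def sign_succ)
  show "mset_A n w = image_mset step (mset_set (sgn_set True))"
    using eq[of True]
    by (simp add: mset_A_def cyclic_pairs_conv filter_mset_image_mset
        filter_mset_mset_set step_def[abs_def] case_prod_beta comp_def multiset.map_comp atLeast0LessThan)
  show "mset_B n w = image_mset step (mset_set (sgn_set False))"
    using eq[of False]
    by (simp add: mset_B_def cyclic_pairs_conv filter_mset_image_mset
        filter_mset_mset_set step_def[abs_def] case_prod_beta comp_def multiset.map_comp atLeast0LessThan)
qed

definition rel :: "nat \<Rightarrow> nat word" where
  "rel i = map (shift n i) w"

lemma length_rel [simp]: "length (rel i) = k"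
  by (simp add: rel_def length)

lemma nth_rel: "p < k \<Longrightarrow> rel i ! p = shift n i (w ! p)"
  by (simp add: rel_def length)

lemma rel_nonempty [simp]: "rel i \<noteq> []"
  using length_rel[of i] k_ge by (metis list.size(3) not_numeral_le_zero)

lemma rels_conv: "rels (cyclic_presentation n w) = rel ` {..<n}"
  by (auto simp: cyclic_presentation_def rel_def theta_power fst_less)

lemma nth_rel_succ:
  assumes "p < k" shows "rel i ! (Suc p mod k) \<noteq> linv (rel i ! p)"
  using assms nth_succ[OF assms] nth_less[of p] nth_less[of "Suc p mod k"]
  by (simp add: nth_rel shift_linv[symmetric] shift_eq_iff)

lemma cyclically_reduced_rel: "cyclically_reduced (rel i)"
  using nth_rel_succ by (subst cyclically_reduced_conv_nth) auto

lemma rel_carrier: "rel i \<in> carrier (F n)"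
  using cyclically_reduced_rel n_pos
  by (auto simp: free_group_def cyclically_reduced_def rel_def)

text \<open>Free redundancy compares only distinct elements of the free group, so the shifts of
  \<open>w\<close> must first be told apart; their initial subscripts do this.\<close>

lemma rel_neq: "i < n \<Longrightarrow> j < n \<Longrightarrow> i \<noteq> j \<Longrightarrow> rel i \<noteq> rel j"
proof
  assume *: "i < n" "j < n" "i \<noteq> j" "rel i = rel j"
  then have "fst (rel i ! 0) = fst (rel j ! 0)" by simp
  then have "(i + fst (w ! 0)) mod n = (j + fst (w ! 0)) mod n"
    using k_ge by (simp add: nth_rel add.commute)
  then show False using mod_add_right_cancel * by blast
qed

text \<open>In an alternating word of even length, a reflection of the positions that reverses all signs
  must interchange two adjacent positions; the word would not be cyclically reduced.\<close>

lemma rel_neq_rotate_winv: "rel i \<noteq> rotate t (winv (rel i))"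
proof
  assume "rel i = rotate t (winv (rel i))"
  then obtain c where c: "c < k" and eq: "rel i = rotate c (winv (rel i))"
    using rotate_reduce_index[of "winv (rel i)" t] by (metis length_rel length_winv rel_nonempty list.size(3) length_0_conv)
  have refl: "rel i ! j = linv (rel i ! (k - 1 - (c + j) mod k))" if "j < k" for j
  proof -
    have lt: "(c + j) mod k < k" using that by simp
    have "rel i ! j = winv (rel i) ! ((c + j) mod k)"
      using arg_cong[OF eq, of "\<lambda>u. u ! j"] that by (simp add: nth_rotate)
    also have "\<dots> = linv (rel i ! (k - 1 - (c + j) mod k))"
      using lt by (simp add: winv_def rev_nth)
    finally show ?thesis .
  qed
  have sgn: "snd (rel i ! p) \<longleftrightarrow> (snd (w ! 0) \<longleftrightarrow> even p)" if "p < k" for p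
    using sign_nth[OF that] that by (simp add: nth_rel)
  \<comment> \<open>Position 0 and its mirror image \<open>k - 1 - c\<close> carry opposite signs,
    so \<open>k - 1 - c\<close> is odd, while \<open>k\<close> is even.\<close>
  have "even c"
  proof -
    have "snd (rel i ! 0) \<longleftrightarrow> \<not> snd (rel i ! (k - 1 - c))"
      using refl[of 0] c by (metis add.right_neutral linv_def mod_less not_gr_zero not_less_zero snd_conv)
    then show ?thesis using sgn[of 0] sgn[of "k - 1 - c"] c even_k by (auto simp: even_diff_nat)
  qed
  then obtain d where d: "c = 2 * d" by blast
  \<comment> \<open>Modulo \<open>k\<close> the reflection sends \<open>j\<close> to
    \<open>- 1 - 2 * d - j\<close>, and for \<open>j = - 1 - d\<close> this is
    \<open>j + 1\<close>.\<close>
  define j where "j = k - 1 - d"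
  have j: "j < k" "c + j = k - 1 + d" using d c by (auto simp: j_def)
  have "k - 1 - (c + j) mod k = Suc j mod k"
  proof (cases "d = 0")
    case True
    then show ?thesis using j k_ge d by (simp add: j_def)
  next
    case False
    then have "c + j = d - 1 + k" using j c d by simp
    then have "(c + j) mod k = d - 1" using c d by simp
    then show ?thesis using False c d by (simp add: j_def)
  qed
  then have "rel i ! (Suc j mod k) = linv (rel i ! j)"
    using refl[OF j(1)] by simp
  then show False using nth_rel_succ j by blast
qed

end

section \<open>A bijective labelling of the edges of the star graph\<close>

locale nonredundant_alternating_word = alternating_word +
  assumes not_proper_power: "\<not> proper_power {0..<n} w"
    and non_redundant: "non_redundant (cyclic_presentation n w)"
begin

lemma rel_not_rotate:
  assumes "i < n" "j < n" "i \<noteq> j"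
  shows "rel i \<noteq> rotate t (rel j)" "rel i \<noteq> rotate t (winv (rel j))"
proof -
  have inv: "inv\<^bsub>F n\<^esub> (rel j) = winv (rel j)"
    using inv_free_group rel_carrier by metis
  have "winv (rel j) \<in> carrier (F n)"
    using group.inv_closed[OF group_free_group rel_carrier[of j]] inv by simp
  moreover have "\<not> freely_redundant (cyclic_presentation n w) (rel i)"
    using non_redundant assms by (auto simp: non_redundant_def rels_conv)
  ultimately show "rel i \<noteq> rotate t (rel j)" "rel i \<noteq> rotate t (winv (rel j))"
    using rel_neq[OF assms] assms inv freely_conjugate_rotate[OF rel_carrier[of i], of _ t]
      rel_carrier[of j]
    by (auto simp: freely_redundant_def rels_conv) (auto simp: cyclic_presentation_def)
qed

text \<open>Cancelling the common rotation and the shift, which is injective on subscripts below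
  \<open>n\<close>, leaves \<open>w\<close> fixed by a nontrivial rotation; then \<open>w\<close>
  would be a proper power.\<close>

lemma rotate_rel_eqD:
  assumes "rotate p (rel i) = rotate q (rel i)" "p < k" "q < k"
  shows "p = q"
proof -
  have "False" if pq: "p < q" "q < k" "rotate p (rel i) = rotate q (rel i)" for p q
  proof -
    have *: "rotate p (map (shift n i) w) = rotate p (map (shift n i) (rotate (q - p) w))"
      using pq by (simp add: rel_def rotate_rotate rotate_map[symmetric])
    then have "map (shift n i) w = map (shift n i) (rotate (q - p) w)"
      using injD[OF inj_fn[OF inj_rotate1]] unfolding rotate_def by blast
    then have "w = rotate (q - p) w"
      by (rule map_inj_on) (auto intro!: inj_onI simp del: split_paired_All simp: shift_eq_iff[OF fst_less fst_less])
    then show False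
      using rotate_fixed_imp_proper_power[OF w, of "q - p"] pq not_proper_power length
        by (simp add: less_imp_diff_less)
  qed
  then show ?thesis using assms by (metis linorder_neqE_nat)
qed

text \<open>Each edge is named by its word read in a relator, never by the one read in an inverse
  relator.\<close>

definition edge :: "nat \<Rightarrow> nat \<Rightarrow> nat word set" where
  "edge i p = {rotate p (rel i), flip (rotate p (rel i))}"

text \<open>Words read in an inverse relator give no further edges, since their flips are rotations
  of the relator itself.\<close>

lemma edges_conv:
  "edges (star_graph (cyclic_presentation n w)) = (\<lambda>(i, p). edge i p) ` ({..<n} \<times> {..<k})"
    (is "?E = ?I")
proof
  show "?I \<subseteq> ?E"
  proof (rule image_subsetI, clarify)
    fix i p assume "i < n" "p < k"
    then have "rotate p (rel i) \<in> sym_closure (rels (cyclic_presentation n w))"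
      unfolding sym_closure_def rels_conv by blast
    then show "edge i p \<in> ?E"
      using k_ge unfolding star_graph_def edge_def by fastforce
  qed
  show "?E \<subseteq> ?I"
  proof
    fix e assume "e \<in> ?E"
    then obtain z where z: "e = {z, flip z}" "length z \<ge> 2"
        "z \<in> sym_closure (rels (cyclic_presentation n w))"
      by (auto simp: star_graph_def)
    have pos: "{rotate t (rel i), flip (rotate t (rel i))} \<in> ?I" if "i < n" for i t
      using rotate_reduce_index[OF rel_nonempty[of i], of t] that by (force simp: edge_def)
    obtain t i where "i < n" and "z = rotate t (rel i) \<or> z = rotate t (winv (rel i))"
      using z by (auto simp: sym_closure_def rels_conv)
    then show "e \<in> ?I"
    proof (elim disjE)
      assume "z = rotate t (winv (rel i))"
      then obtain j where "winv z = rotate j (rel i)" using winv_rotate winv_winv by metis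
      then have "flip z = rotate (length z - 2 + j) (rel i)"
        using flip_conv_rotate[OF z(2)] by (simp add: rotate_rotate)
      then show ?thesis
        using pos[OF \<open>i < n\<close>] z flip_flip[OF z(2)] by (metis doubleton_eq_iff)
    qed (use z pos in auto)
  qed
qed

text \<open>If two edges coincide, a rotated relator equals another one or the flip of one, which is
  a rotated inverse. Between different relators non-redundancy forbids both; within a single relator
  the \<open>k\<close> rotations are distinct and none is a rotation of the inverse.\<close>

lemma inj_edge: "inj_on (\<lambda>(i, p). edge i p) ({..<n} \<times> {..<k})"
proof (rule inj_onI, clarsimp)
  fix i p j q assume a: "i < n" "p < k" "j < n" "q < k" "edge i p = edge j q"
  have "rotate p (rel i) = rotate q (rel j) \<or> rotate p (rel i) = flip (rotate q (rel j))"
    using a(5) by (auto simp: edge_def doubleton_eq_iff)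
  then show "i = j \<and> p = q"
  proof
    assume eq: "rotate p (rel i) = rotate q (rel j)"
    have "i = j" using rotate_eq_swap[OF eq] rel_not_rotate(1) a by metis
    then show ?thesis using eq rotate_rel_eqD a by blast
  next
    assume eq: "rotate p (rel i) = flip (rotate q (rel j))"
    obtain t where "winv (rotate q (rel j)) = rotate t (winv (rel j))"
      using winv_rotate by metis
    then have "flip (rotate q (rel j)) = rotate (k - 2 + t) (winv (rel j))"
      using flip_conv_rotate[of "rotate q (rel j)"] k_ge by (simp add: rotate_rotate)
    then obtain t' where "rel i = rotate t' (winv (rel j))"
      using eq rotate_eq_swap by metis
    then show ?thesis using rel_not_rotate(2) rel_neq_rotate_winv a by metis
  qed
qed

lemma hd_flip: "length z \<ge> 2 \<Longrightarrow> hd (flip z) = linv (z ! 1)"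
  by (cases z rule: flip.cases) auto

text \<open>Here the star graph splits by sign: the flip begins with the inverse of the next letter,
  whose sign is opposite by alternation, so both ends have the sign of the letter at
  \<open>p\<close>.\<close>

lemma ends_edge:
  assumes "p < k"
  shows "ends (star_graph (cyclic_presentation n w)) (edge i p) =
    {((fst (w ! p) + i) mod n, snd (w ! p)), ((fst (w ! p) + i + step p) mod n, snd (w ! p))}"
proof -
  have "hd (rotate p (rel i)) = shift n i (w ! p)"
    using assms by (simp add: hd_rotate_conv_nth nth_rel)
  moreover have "hd (flip (rotate p (rel i))) = linv (shift n i (w ! (Suc p mod k)))"
    using k_ge assms by (simp add: hd_flip nth_rotate nth_rel)
  moreover have "linv (shift n i (w ! (Suc p mod k))) =
      ((fst (w ! p) + i + step p) mod n, snd (w ! p))"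
  proof -
    have "(fst (w ! (Suc p mod k)) + i) mod n = (fst (w ! p) + i + step p) mod n"
      unfolding step_add[OF assms, symmetric] by (simp add: mod_simps ac_simps)
    then show ?thesis using sign_succ[OF assms] by (auto simp: linv_def)
  qed
  ultimately show ?thesis by (simp add: star_graph_def edge_def shift_def case_prod_beta)
qed

text \<open>Relabels edges by the subscript at which they start: position \<open>p\<close> of
  relator \<open>i\<close> has subscript \<open>j\<close> when \<open>i\<close> is
  \<open>j - fst (w ! p)\<close> modulo \<open>n\<close>.\<close>

definition edge_at :: "nat \<times> nat \<Rightarrow> nat word set" where
  "edge_at = (\<lambda>(j, p). edge ((j + (n - fst (w ! p))) mod n) p)"

lemma ends_edge_at:
  assumes "p < k" "j < n"
  shows "ends (star_graph (cyclic_presentation n w)) (edge_at (j, p)) =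
    {(j, snd (w ! p)), ((j + step p) mod n, snd (w ! p))}"
proof -
  have eq: "(fst (w ! p) + (j + (n - fst (w ! p))) mod n) mod n = j"
    using nth_less[of p] assms by (simp add: mod_simps)
  then show ?thesis
    using assms by (simp add: edge_at_def ends_edge) (metis mod_add_left_eq)
qed

lemma bij_edge_at:
  "bij_betw edge_at ({..<n} \<times> {..<k}) (edges (star_graph (cyclic_presentation n w)))"
proof -
  let ?h = "\<lambda>(j, p). ((j + (n - fst (w ! p))) mod n, p)"
  have "inj_on ?h ({..<n} \<times> {..<k})"
    by (rule inj_onI) (use mod_add_right_cancel in auto)
  moreover have "?h ` ({..<n} \<times> {..<k}) \<subseteq> {..<n} \<times> {..<k}"
    using n_pos by auto
  ultimately have "bij_betw ?h ({..<n} \<times> {..<k}) ({..<n} \<times> {..<k})"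
    by (simp add: bij_betw_def endo_inj_surj)
  moreover have "bij_betw (\<lambda>(i, p). edge i p) ({..<n} \<times> {..<k})
      (edges (star_graph (cyclic_presentation n w)))"
    by (simp add: bij_betw_def inj_edge edges_conv)
  ultimately have "bij_betw ((\<lambda>(i, p). edge i p) \<circ> ?h) ({..<n} \<times> {..<k})
      (edges (star_graph (cyclic_presentation n w)))"
    by (rule bij_betw_trans)
  moreover have "(\<lambda>(i, p). edge i p) \<circ> ?h = edge_at"
    by (auto simp: edge_at_def fun_eq_iff)
  ultimately show ?thesis by simp
qed

lemma verts_star_graph: "verts (star_graph (cyclic_presentation n w)) = {..<n} \<times> UNIV"
  by (auto simp: star_graph_def cyclic_presentation_def)

end

context alternating_word
begin

text \<open>Walking around the word from an occurrence of the generator 0, the subscript changes by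
  one step at a time, modulo \<open>n\<close>. So \<open>g\<close> divides every subscript as well
  as \<open>n\<close>, hence their greatest common divisor.\<close>

lemma irreducible_step:
  assumes "0 \<in> subscripts w" "irreducible_cyclic n w" and g: "g dvd n" "\<And>p. p < k \<Longrightarrow> g dvd step p"
  shows "g = 1"
proof -
  obtain p0 where p0: "p0 < k" "fst (w ! p0) = 0"
    using assms(1) length by (auto simp: subscripts_def in_set_conv_nth)
  have dvd: "g dvd fst (w ! ((p0 + t) mod k))" for t
  proof (induction t)
    case 0
    then show ?case using p0 by simp
  next
    case (Suc t)
    let ?q = "(p0 + t) mod k"
    have q: "?q < k" using k_ge by simp
    have "g dvd (fst (w ! ?q) + step ?q) mod n"
      using Suc g(1) g(2)[OF q] by (intro dvd_mod dvd_add)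
    then show ?case unfolding step_add[OF q] by (simp add: mod_Suc_eq)
  qed
  have "g dvd fst (w ! p)" if "p < k" for p
  proof -
    have "(p0 + (p + k - p0)) mod k = p" using that p0 by simp
    then show ?thesis using dvd[of "p + k - p0"] by simp
  qed
  then have "\<forall>l\<in>set w. g dvd fst l" using length by (metis in_set_conv_nth)
  then have "g dvd Gcd (insert n (subscripts w))"
    using g(1) by (intro Gcd_greatest) (auto simp: subscripts_def)
  then have "g dvd 1" using assms(2) unfolding irreducible_cyclic_def by metis
  then show ?thesis by simp
qed

end

section \<open>Translation of the multiset conditions, and the equivalence\<close>

lemma count_image_mset_set_eq_1_iff:
  assumes "finite A"
  shows "(\<forall>a\<in>#image_mset f (mset_set A). count (image_mset f (mset_set A)) a = 1) \<longleftrightarrow> inj_on f A"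
proof
  assume "inj_on f A"
  then show "\<forall>a\<in>#image_mset f (mset_set A). count (image_mset f (mset_set A)) a = 1"
    using assms by (simp add: image_mset_mset_set)
next
  assume *: "\<forall>a\<in>#image_mset f (mset_set A). count (image_mset f (mset_set A)) a = 1"
  show "inj_on f A"
  proof (rule inj_onI)
    fix x y assume xy: "x \<in> A" "y \<in> A" "f x = f y"
    have "{z. z \<in># mset_set A \<and> f x = f z} = {z \<in> A. f z = f x}" using assms by auto
    then have "count (image_mset f (mset_set A)) (f x) = card {z \<in> A. f z = f x}"
      using assms by (simp add: count_image_mset')
    then have "card {z \<in> A. f z = f x} = 1" using * xy assms by auto
    moreover have "x \<in> {z \<in> A. f z = f x}" "y \<in> {z \<in> A. f z = f x}" using xy by simp_all
    ultimately show "x = y" by (metis card_1_singletonE singletonD)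
  qed
qed

text \<open>Moves the conditions from values with multiplicity to positions. As
  \<open>f p < n\<close>, the difference \<open>n - f p\<close> is not truncated, so it equals
  \<open>f q\<close> exactly when the two values add up to \<open>n\<close>.\<close>

lemma mset_steps_iff:
  fixes f :: "nat \<Rightarrow> nat"
  assumes "finite A" "card A = h" "\<And>p. p \<in> A \<Longrightarrow> f p < n" "M = image_mset f (mset_set A)"
  shows "size M = h \<and> (\<forall>a\<in>#M. count M a = 1 \<and> odd a) \<and> (\<forall>a\<in>#M. n - a \<notin># M) \<longleftrightarrow>
    inj_on f A \<and> (\<forall>p\<in>A. odd (f p)) \<and> (\<forall>p\<in>A. \<forall>q\<in>A. f p + f q \<noteq> n)"
proof -
  have set: "set_mset M = f ` A" using assms(1,4) by simp
  have eq: "n - f p \<noteq> f q \<longleftrightarrow> f p + f q \<noteq> n" if "p \<in> A" for p q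
    using assms(3)[OF that] by auto
  have "(\<forall>a\<in>#M. n - a \<notin># M) \<longleftrightarrow> (\<forall>p\<in>A. \<forall>q\<in>A. n - f p \<noteq> f q)"
    unfolding set image_iff by simp
  also have "\<dots> \<longleftrightarrow> (\<forall>p\<in>A. \<forall>q\<in>A. f p + f q \<noteq> n)"
    by (intro ball_cong refl eq)
  finally have "(\<forall>a\<in>#M. n - a \<notin># M) \<longleftrightarrow> (\<forall>p\<in>A. \<forall>q\<in>A. f p + f q \<noteq> n)" .
  moreover have "(\<forall>a\<in>#M. odd a) \<longleftrightarrow> (\<forall>p\<in>A. odd (f p))" unfolding set by blast
  moreover have "(\<forall>a\<in>#M. count M a = 1) \<longleftrightarrow> inj_on f A"
    unfolding assms(4) by (rule count_image_mset_set_eq_1_iff[OF assms(1)])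
  moreover have "size M = h" using assms by simp
  ultimately show ?thesis by (simp only: ball_conj_distrib simp_thms conj_assoc)
qed

theorem theorem4:
  fixes n k \<nu> :: nat and w :: "nat word"
  assumes "n \<ge> 1" and "\<nu> \<ge> 1"
    and "w \<in> carrier (F n)" and "cyclically_reduced w" and "alternating w"
    and "length w = k" and "even k" and "k \<ge> 4"
    and "\<not> proper_power {0..<n} w"
    and "0 \<in> subscripts w"
    and "irreducible_cyclic n w"
    and "non_redundant (cyclic_presentation n w)"
  shows "special 2 k \<nu> (cyclic_presentation n w) \<longleftrightarrow>
    n = 2 * k \<and> \<nu> = 2 \<and>
    size (mset_A n w) = k div 2 \<and> (\<forall>a\<in>#mset_A n w. count (mset_A n w) a = 1 \<and> odd a) \<and>
    size (mset_B n w) = k div 2 \<and> (\<forall>b\<in>#mset_B n w. count (mset_B n w) b = 1 \<and> odd b) \<and>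
    (\<forall>a\<in>#mset_A n w. n - a \<notin># mset_A n w) \<and>
    (\<forall>b\<in>#mset_B n w. n - b \<notin># mset_B n w)"
    (is "?special \<longleftrightarrow> ?rhs")
proof -
  interpret W: nonredundant_alternating_word n k w
    by unfold_locales (use assms in auto)
  let ?P = "cyclic_presentation n w" and ?G = "star_graph (cyclic_presentation n w)"
  let ?s = "\<lambda>p. snd (w ! p)"
  have circ: "circulant_pair n k ?s W.step ?G W.edge_at"
  proof
    show "card {p. p < k \<and> snd (w ! p) = b} = k div 2" for b
      using W.card_sgn_set[of b] by (simp add: W.sgn_set_def)
  qed (use W.verts_star_graph W.bij_edge_at W.ends_edge_at W.even_k W.k_ge W.step_pos W.step_less
        in auto)
  interpret C: circulant_pair n k ?s W.step ?G W.edge_at by (rule circ)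
  have S: "C.S b = W.sgn_set b" for b by (simp add: C.S_def W.sgn_set_def)
  \<comment> \<open>With the sizes \<open>k div 2\<close> already known, \<open>good True\<close>
    expresses the conditions on \<A> and \<open>good False\<close> those on \<B>.\<close>
  define good where "good b \<longleftrightarrow> inj_on W.step (C.S b) \<and> (\<forall>p\<in>C.S b. odd (W.step p)) \<and>
    (\<forall>p\<in>C.S b. \<forall>q\<in>C.S b. W.step p + W.step q \<noteq> n)" for b
  note good_True = mset_steps_iff[OF C.finite_S C.card_S W.step_less W.mset_A_conv[folded S],
      folded good_def, symmetric]
  note good_False = mset_steps_iff[OF C.finite_S C.card_S W.step_less W.mset_B_conv[folded S],
      folded good_def, symmetric]
  have "?rhs \<longleftrightarrow> n = 2 * k \<and> \<nu> = 2 \<and> good True \<and> good False"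
    unfolding good_True good_False by (rule iffI; elim conjE; intro conjI; assumption)
  also have "\<dots> \<longleftrightarrow> n = 2 * k \<and> \<nu> = 2 \<and> (\<forall>b. good b)"
    by (metis (full_types))
  also have "\<dots> \<longleftrightarrow> ?special"
  proof
    assume sp: ?special
    have "C.K b \<in> components ?G" for b
      using C.verts C.n_pos by (simp add: components_def)
    then have K: "bipartite (C.K b)" "diameter (C.K b) = 2" "girth (C.K b) = 4" for b
      using sp by (auto simp: special_def numeral_eq_enat)
    note imp = C.special_imp[OF W.irreducible_step[OF assms(10,11)] K]
    have "card (components ?G) = \<nu>" using sp by (simp add: special_def)
    then show "n = 2 * k \<and> \<nu> = 2 \<and> (\<forall>b. good b)"
      unfolding good_def using imp by simp
  next
    assume r: "n = 2 * k \<and> \<nu> = 2 \<and> (\<forall>b. good b)"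
    interpret O: odd_circulant_pair n k ?s W.step ?G W.edge_at
      by unfold_locales (use r in \<open>auto simp: good_def\<close>)
    have "finite_presentation ?P"
      using W.rel_carrier
      by (auto simp: finite_presentation_def W.rels_conv) (auto simp: cyclic_presentation_def)
    moreover have "finite (components ?G)" unfolding O.components_eq by simp
    moreover have "\<forall>r\<in>rels ?P. cyclically_reduced r" "\<forall>r\<in>rels ?P. length r = k"
      by (simp_all add: W.rels_conv W.cyclically_reduced_rel)
    ultimately show ?special
      using r assms(8) O.card_components O.isomorphic_K O.K_graph O.degree_K
      unfolding special_def O.components_eq by (simp add: numeral_eq_enat)
  qed
  finally show ?thesis by blast
qed

end
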